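(* Let $(X,\mathcal{M},\mu)$ be a complete, $\sigma$-finite measure space such that $L^2(X)$ is separable, let $\mathscr{H}$ be a separable Hilbert space, and let $\mathcal{A}$ be a countable dense subset of $L^2(X;\mathscr{H})$. Suppose that $W\subset L^2(X;\mathscr{H})$ is a closed subspace satisfying the orthogonality condition: for any $\xi\in L^2(X;\mathscr{H})$, $$\xi\perp W \implies \xi(x)\perp J_W^{\mathcal{A}}(x)\ \text{for a.e. } x .$$ Then, regarding $\int_X^\oplus J_W^{\mathcal{A}}(x)\,d\mu(x)$ as a subspace of $L^2(X;\mathscr{H})$, we have $$W = \int_{X}^\oplus J_W^{\mathcal{A}}(x)\,d\mu(x).$$
   Context: $L^2(X;\mathscr{H})$ is the Hilbert space of a.e.-classes of weakly measurable $\xi:X\to\mathscr{H}$ with $\int_X\|\xi(x)\|^2d\mu<\infty$. For a closed subspace $W$ let $P_W$ be the orthogonal projection onto $W$. The range function $J_W^{\mathcal{A}}$ is defined as follows: for each $\Phi\in\mathcal{A}$ choose an everywhere-defined representative $f(\Phi)$ of the class $P_W\Phi$, and let $J_W^{\mathcal{A}}(x)$ be the closed linear span in $\mathscr{H}$ of $\{f(\Phi)(x):\Phi\in\mathcal{A}\}$; up to a.e. equality it does not depend on the choice of representatives. A range function $J$ is a map from $X$ to closed subspaces of $\mathscr{H}$; it is measurable if $x\mapsto\langle P_J(x)a,b\rangle$ is measurable for all $a,b\in\mathscr{H}$, where $P_J(x)$ is the orthogonal projection onto $J(x)$. Under the orthogonality condition $J_W^{\mathcal{A}}$ is measurable. For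 a measurable range function $J$, the direct integral $\int_X^\oplus J(x)\,d\mu(x)$, regarded as a subspace of $L^2(X;\mathscr{H})$, consists of the $\xi\in L^2(X;\mathscr{H})$ with $\xi(x)\in J(x)$ for a.e. $x$. *)

theory Defs
  imports "HOL-Analysis.Analysis"
begin

section \<open>Complex Hilbert spaces\<close>

text \<open>
  A complex inner product space is a real inner product space whose real inner product is the
  real part of \<open>cinner\<close>. Hence norm, metric and topology are the ones of
  \<^class>\<open>real_inner\<close>, and \<open>(norm x)\<^sup>2 = cinner x x\<close>. The form is linear in its first argument.
\<close>

class complex_inner = real_inner +
  fixes scaleC :: "complex \<Rightarrow> 'a \<Rightarrow> 'a" (infixr \<open>*\<^sub>C\<close> 75)
    and cinner :: "'a \<Rightarrow> 'a \<Rightarrow> complex"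
  assumes scaleC_add_right: "c *\<^sub>C (x + y) = c *\<^sub>C x + c *\<^sub>C y"
    and scaleC_add_left: "(c + d) *\<^sub>C x = c *\<^sub>C x + d *\<^sub>C x"
    and scaleC_scaleC: "c *\<^sub>C d *\<^sub>C x = (c * d) *\<^sub>C x"
    and scaleR_scaleC: "scaleR r x = complex_of_real r *\<^sub>C x"
    and cinner_commute: "cinner x y = cnj (cinner y x)"
    and cinner_add_left: "cinner (x + y) z = cinner x z + cinner y z"
    and cinner_scaleC_left: "cinner (c *\<^sub>C x) y = c * cinner x y"
    and inner_eq_Re_cinner: "inner x y = Re (cinner x y)"

class complex_hilbert = complex_inner + complete_space

instantiation complex :: complex_hilbert
begin

definition scaleC_complex :: "complex \<Rightarrow> complex \<Rightarrow> complex"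
  where "scaleC_complex c z = c * z"

definition cinner_complex :: "complex \<Rightarrow> complex \<Rightarrow> complex"
  where "cinner_complex z w = z * cnj w"

instance
  by standard
    (simp_all add: scaleC_complex_def cinner_complex_def inner_complex_def algebra_simps
      scaleR_conv_of_real)

end

global_interpretation complex_vector:
  vector_space "scaleC :: complex \<Rightarrow> 'a \<Rightarrow> 'a::complex_inner"
  defines csubspace = complex_vector.subspace
    and cspan = complex_vector.span
proof
  show "1 *\<^sub>C x = x" for x :: 'a
    using scaleR_scaleC[of 1 x] by simp
qed (simp_all add: scaleC_add_right scaleC_add_left scaleC_scaleC)

definition orth_proj :: "'h::complex_inner set \<Rightarrow> 'h \<Rightarrow> 'h"
  where "orth_proj S a = (THE p. p \<in> S \<and> (\<forall>s\<in>S. cinner (a - p) s = 0))"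


section \<open>The space of square integrable vector-valued functions modulo a.e. equality\<close>

text \<open>
  An element of \<open>L2 M\<close> is an equivalence class, i.e. a set of everywhere-defined functions.
  The operations below go through an arbitrary representative \<open>L2_rep\<close>; for separable
  \<open>'h\<close> and elements of \<open>L2 M\<close> the results do not depend on it.
\<close>

definition weakly_measurable :: "'a measure \<Rightarrow> ('a \<Rightarrow> 'h::complex_inner) \<Rightarrow> bool"
  where "weakly_measurable M \<xi> \<longleftrightarrow> (\<forall>a. (\<lambda>x. cinner (\<xi> x) a) \<in> borel_measurable M)"

definition square_integrable :: "'a measure \<Rightarrow> ('a \<Rightarrow> 'h::complex_inner) set"
  where "square_integrable M =
    {\<xi>. weakly_measurable M \<xi> \<and> integrable M (\<lambda>x. (norm (\<xi> x))\<^sup>2)}"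

definition ae_eq_rel :: "'a measure \<Rightarrow> ('a \<Rightarrow> 'h::complex_inner) rel"
  where "ae_eq_rel M =
    {(\<xi>, \<eta>). \<xi> \<in> square_integrable M \<and> \<eta> \<in> square_integrable M \<and> (AE x in M. \<xi> x = \<eta> x)}"

definition L2 :: "'a measure \<Rightarrow> ('a \<Rightarrow> 'h::complex_inner) set set"
  where "L2 M = square_integrable M // ae_eq_rel M"

definition L2_class :: "'a measure \<Rightarrow> ('a \<Rightarrow> 'h::complex_inner) \<Rightarrow> ('a \<Rightarrow> 'h) set"
  where "L2_class M \<xi> = ae_eq_rel M `` {\<xi>}"

definition L2_rep :: "('a \<Rightarrow> 'h) set \<Rightarrow> 'a \<Rightarrow> 'h"
  where "L2_rep F = (SOME \<xi>. \<xi> \<in> F)"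

definition L2_zero :: "'a measure \<Rightarrow> ('a \<Rightarrow> 'h::complex_inner) set"
  where "L2_zero M = L2_class M (\<lambda>_. 0)"

definition L2_add ::
    "'a measure \<Rightarrow> ('a \<Rightarrow> 'h::complex_inner) set \<Rightarrow> ('a \<Rightarrow> 'h) set \<Rightarrow> ('a \<Rightarrow> 'h) set"
  where "L2_add M F G = L2_class M (\<lambda>x. L2_rep F x + L2_rep G x)"

definition L2_diff ::
    "'a measure \<Rightarrow> ('a \<Rightarrow> 'h::complex_inner) set \<Rightarrow> ('a \<Rightarrow> 'h) set \<Rightarrow> ('a \<Rightarrow> 'h) set"
  where "L2_diff M F G = L2_class M (\<lambda>x. L2_rep F x - L2_rep G x)"

definition L2_scale ::
    "'a measure \<Rightarrow> complex \<Rightarrow> ('a \<Rightarrow> 'h::complex_inner) set \<Rightarrow> ('a \<Rightarrow> 'h) set"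
  where "L2_scale M c F = L2_class M (\<lambda>x. c *\<^sub>C L2_rep F x)"

definition L2_inner ::
    "'a measure \<Rightarrow> ('a \<Rightarrow> 'h::complex_inner) set \<Rightarrow> ('a \<Rightarrow> 'h) set \<Rightarrow> complex"
  where "L2_inner M F G = (LINT x|M. cinner (L2_rep F x) (L2_rep G x))"

definition L2_dist ::
    "'a measure \<Rightarrow> ('a \<Rightarrow> 'h::complex_inner) set \<Rightarrow> ('a \<Rightarrow> 'h) set \<Rightarrow> real"
  where "L2_dist M F G = sqrt (LINT x|M. (norm (L2_rep F x - L2_rep G x))\<^sup>2)"

definition L2_topology :: "'a measure \<Rightarrow> ('a \<Rightarrow> 'h::complex_inner) set topology"
  where "L2_topology M = Metric_space.mtopology (L2 M) (L2_dist M)"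

definition L2_closed_subspace :: "'a measure \<Rightarrow> ('a \<Rightarrow> 'h::complex_inner) set set \<Rightarrow> bool"
  where "L2_closed_subspace M W \<longleftrightarrow>
    W \<subseteq> L2 M \<and> L2_zero M \<in> W \<and>
    (\<forall>F\<in>W. \<forall>G\<in>W. L2_add M F G \<in> W) \<and>
    (\<forall>c. \<forall>F\<in>W. L2_scale M c F \<in> W) \<and>
    closedin (L2_topology M) W"

definition L2_proj ::
    "'a measure \<Rightarrow> ('a \<Rightarrow> 'h::complex_inner) set set \<Rightarrow> ('a \<Rightarrow> 'h) set \<Rightarrow> ('a \<Rightarrow> 'h) set"
  where "L2_proj M W F = (THE P. P \<in> W \<and> (\<forall>G\<in>W. L2_inner M (L2_diff M F P) G = 0))"


section \<open>Range functions and direct integrals\<close>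

text \<open>
  In \<open>range_fun A f\<close>, the set \<open>A\<close> consists of classes and \<open>f \<Phi>\<close> is meant to be a chosen
  representative of the projection of \<open>\<Phi>\<close> onto \<open>W\<close>, that is, \<open>f \<Phi> \<in> L2_proj M W \<Phi>\<close>.
\<close>

definition range_fun ::
    "('a \<Rightarrow> 'h::complex_inner) set set \<Rightarrow> (('a \<Rightarrow> 'h) set \<Rightarrow> 'a \<Rightarrow> 'h) \<Rightarrow> 'a \<Rightarrow> 'h set"
  where "range_fun A f x = closure (cspan ((\<lambda>\<Phi>. f \<Phi> x) ` A))"

definition measurable_range_function :: "'a measure \<Rightarrow> ('a \<Rightarrow> 'h::complex_inner set) \<Rightarrow> bool"
  where "measurable_range_function M J \<longleftrightarrow>
    (\<forall>x\<in>space M. csubspace (J x) \<and> closed (J x)) \<and>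
    (\<forall>a b. (\<lambda>x. cinner (orth_proj (J x) a) b) \<in> borel_measurable M)"

text \<open>
  The direct integral is a partial notion: it is left unspecified unless \<open>J\<close> is a measurable
  range function.
\<close>

definition direct_integral ::
    "'a measure \<Rightarrow> ('a \<Rightarrow> 'h::complex_inner set) \<Rightarrow> ('a \<Rightarrow> 'h) set set"
  where "direct_integral M J =
    (if measurable_range_function M J then {F \<in> L2 M. AE x in M. L2_rep F x \<in> J x}
     else undefined)"

definition orthogonality_condition ::
    "'a measure \<Rightarrow> ('a \<Rightarrow> 'h::complex_inner) set set \<Rightarrow> ('a \<Rightarrow> 'h set) \<Rightarrow> bool"
  where "orthogonality_condition M W J \<longleftrightarrow>
    (\<forall>F\<in>L2 M. (\<forall>G\<in>W. L2_inner M F G = 0) \<longrightarrow>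
      (AE x in M. \<forall>v\<in>J x. cinner (L2_rep F x) v = 0))"

end

theory Submission
  imports Defs
begin

text \<open>
  Write \<open>J\<close> for the range function \<open>range_fun A f\<close>. The orthogonality condition forces the
  projection onto \<open>W\<close> to act fibre by fibre: for every square integrable \<open>\<xi>\<close> with projection \<open>p\<close>, the
  vector \<open>p x\<close> is the orthogonal projection of \<open>\<xi> x\<close> onto \<open>J x\<close> for almost every \<open>x\<close>
  (\<open>pointwise_projection\<close>). Two facts give this. First, elements of \<open>W\<close> take almost all their values
  in \<open>J\<close> (\<open>AE_in_range_fun\<close>): projections do not increase the distance to an element of \<open>W\<close>, so the
  family \<open>f \<Phi>\<close> is dense in \<open>W\<close>, and approximation in the square norm at a summable rate implies almost
  everywhere convergence. Second, \<open>\<xi> - p\<close> is orthogonal to \<open>W\<close>, so the condition applies to it.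

  The three parts of the theorem are then short. The inclusion of \<open>W\<close> in the direct integral is the
  first fact. Conversely, if \<open>\<xi> x \<in> J x\<close> almost everywhere, then \<open>\<xi> x - p x\<close> is in \<open>J x\<close> and
  orthogonal to it, so \<open>\<xi> = p\<close> belongs to \<open>W\<close> (\<open>direct_integral_subset\<close>). Finally \<open>J\<close> is measurable
  (\<open>measurable_range_fun\<close>), since the fibrewise projection of a fixed vector can be read off from the
  projection of that vector multiplied by a positive square integrable weight.

  All this presupposes that the projection onto \<open>W\<close> exists, which is the longer part of the work:
  the square integrable functions form a complete space (\<open>L2_Cauchy_limit\<close>), nearest points in closed
  subspaces exist (\<open>L2_nearest_point\<close>), and the construction passes to classes modulo almost
  everywhere equality (\<open>L2_proj_unique_existence\<close>). Separability of the space of values makes the norm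
  of a weakly measurable function measurable.
\<close>

section \<open>The complex inner product in terms of the real one\<close>

lemma Re_cinner: "Re (cinner x y) = inner x y"
  by (simp add: inner_eq_Re_cinner)

lemma cinner_scaleC_right: "cinner x (c *\<^sub>C y) = cnj c * cinner x y"
  by (metis cinner_commute cinner_scaleC_left complex_cnj_mult)

lemma Im_cinner: "Im (cinner x y) = inner x (\<i> *\<^sub>C y)"
  by (simp add: inner_eq_Re_cinner cinner_scaleC_right)

text \<open>
  The complex form is recovered from the real inner product by pairing with \<open>y\<close> and \<open>\<i> *\<^sub>C y\<close>.
  Measurability, integrability and orthogonality can therefore be treated for the real inner
  product, as long as the sets of test vectors are stable under multiplication by \<open>\<i>\<close>.
\<close>

lemma cinner_conv_inner: "cinner x y = Complex (inner x y) (inner x (\<i> *\<^sub>C y))"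
  by (simp add: complex_eq_iff Re_cinner Im_cinner)

lemma cinner_self: "cinner x x = complex_of_real ((norm x)\<^sup>2)"
proof -
  have "Im (cinner x x) = - Im (cinner x x)"
    by (metis cinner_commute cnj.simps(2))
  then show ?thesis
    by (simp add: complex_eq_iff Re_cinner dot_square_norm)
qed

lemma norm_scaleC: "norm (c *\<^sub>C x) = cmod c * norm (x :: 'h::complex_inner)"
proof -
  have "complex_of_real ((norm (c *\<^sub>C x))\<^sup>2) = c * cnj c * complex_of_real ((norm x)\<^sup>2)"
    by (simp only: cinner_self[symmetric] cinner_scaleC_left cinner_scaleC_right mult_ac)
  also have "\<dots> = complex_of_real ((cmod c * norm x)\<^sup>2)"
    by (simp add: power_mult_distrib complex_norm_square[symmetric])
  finally have "(norm (c *\<^sub>C x))\<^sup>2 = (cmod c * norm x)\<^sup>2"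
    using of_real_eq_iff by blast
  then show ?thesis by simp
qed

lemma cinner_diff_left: "cinner (x - y) z = cinner x z - cinner y z"
  by (simp add: cinner_conv_inner inner_diff_left complex_eq_iff)

lemma cinner_scaleR_left: "cinner (r *\<^sub>R x) z = complex_of_real r * cinner x z"
  by (simp add: scaleR_scaleC cinner_scaleC_left)

lemma csubspace_diff: "csubspace S \<Longrightarrow> x \<in> S \<Longrightarrow> y \<in> S \<Longrightarrow> x - y \<in> S"
  by (rule complex_vector.subspace_diff)

lemma csubspace_scaleR: "csubspace S \<Longrightarrow> x \<in> S \<Longrightarrow> r *\<^sub>R x \<in> S"
  by (simp add: scaleR_scaleC complex_vector.subspace_scale)

text \<open>
  If \<open>p\<close> and \<open>q\<close> both qualify as the projection of \<open>a\<close>, then \<open>p - q\<close> lies in \<open>S\<close> and is orthogonal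
  to \<open>S\<close>, hence to itself. So any vector exhibited with the two properties is the value of
  \<open>orth_proj\<close>; in the fibres of the range function such a vector comes from the projection onto \<open>W\<close>.
\<close>

lemma orth_proj_eqI:
  assumes S: "csubspace S" and p: "p \<in> S" and orth: "\<And>s. s \<in> S \<Longrightarrow> cinner (a - p) s = 0"
  shows "orth_proj S a = p"
  unfolding orth_proj_def
proof (rule the_equality)
  fix q assume q: "q \<in> S \<and> (\<forall>s\<in>S. cinner (a - q) s = 0)"
  have "p - q \<in> S" using csubspace_diff S p q by blast
  then have "cinner ((a - q) - (a - p)) (p - q) = 0"
    using q orth by (simp add: cinner_diff_left)
  then have "cinner (p - q) (p - q) = 0" by simp
  then show "q = p" by (simp add: cinner_self)
qed (use p orth in auto)

lemma csubspace_closure: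
  fixes S :: "'h::complex_inner set"
  assumes "csubspace S"
  shows "csubspace (closure S)"
proof (rule complex_vector.subspaceI)
  show "0 \<in> closure S"
    using assms closure_subset complex_vector.subspace_0 by blast
next
  fix x y assume "x \<in> closure S" "y \<in> closure S"
  then obtain u v where "\<forall>n. u n \<in> S" "u \<longlonglongrightarrow> x" "\<forall>n. v n \<in> S" "v \<longlonglongrightarrow> y"
    unfolding closure_sequential by blast
  then have "\<forall>n. u n + v n \<in> S" "(\<lambda>n. u n + v n) \<longlonglongrightarrow> x + y"
    using assms by (auto intro: complex_vector.subspace_add tendsto_add)
  then show "x + y \<in> closure S"
    unfolding closure_sequential by (intro exI[of _ "\<lambda>n. u n + v n"]) simp
next
  fix c and x assume "x \<in> closure S"
  then obtain u where u: "\<forall>n. u n \<in> S" "u \<longlonglongrightarrow> x"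
    unfolding closure_sequential by blast
  have "(\<lambda>n. cmod c * norm (u n - x)) \<longlonglongrightarrow> cmod c * norm (x - x)"
    by (intro tendsto_intros u)
  then have "(\<lambda>n. norm (c *\<^sub>C u n - c *\<^sub>C x)) \<longlonglongrightarrow> 0"
    by (simp add: norm_scaleC complex_vector.scale_right_diff_distrib[symmetric])
  then have "(\<lambda>n. c *\<^sub>C u n) \<longlonglongrightarrow> c *\<^sub>C x"
    by (simp add: LIM_zero_iff tendsto_norm_zero_iff)
  moreover have "\<forall>n. c *\<^sub>C u n \<in> S"
    using assms u by (auto intro: complex_vector.subspace_scale)
  ultimately show "c *\<^sub>C x \<in> closure S"
    unfolding closure_sequential by (intro exI[of _ "\<lambda>n. c *\<^sub>C u n"]) simp
qed


section \<open>Weakly measurable functions with values in a separable space\<close>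

lemma weakly_measurable_iff_inner:
  "weakly_measurable M \<xi> \<longleftrightarrow> (\<forall>a. (\<lambda>x. inner (\<xi> x) a) \<in> borel_measurable M)"
proof
  assume *: "weakly_measurable M \<xi>"
  show "\<forall>a. (\<lambda>x. inner (\<xi> x) a) \<in> borel_measurable M"
  proof
    fix a
    have [measurable]: "(\<lambda>x. cinner (\<xi> x) a) \<in> borel_measurable M"
      using * by (simp add: weakly_measurable_def)
    have "(\<lambda>x. Re (cinner (\<xi> x) a)) \<in> borel_measurable M"
      by measurable
    then show "(\<lambda>x. inner (\<xi> x) a) \<in> borel_measurable M"
      by (simp add: Re_cinner)
  qed
next
  assume *[measurable]: "\<forall>a. (\<lambda>x. inner (\<xi> x) a) \<in> borel_measurable M"
  show "weakly_measurable M \<xi>"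
    unfolding weakly_measurable_def
  proof
    fix a
    show "(\<lambda>x. cinner (\<xi> x) a) \<in> borel_measurable M"
      by (subst borel_measurable_complex_iff) (use * in \<open>simp add: Re_cinner Im_cinner\<close>)
  qed
qed

lemma inner_scaleC_left: "inner (c *\<^sub>C x) y = inner x (cnj c *\<^sub>C y)"
  by (simp add: inner_eq_Re_cinner cinner_scaleC_left cinner_scaleC_right)

lemma weakly_measurable_add:
  "weakly_measurable M \<xi> \<Longrightarrow> weakly_measurable M \<eta> \<Longrightarrow> weakly_measurable M (\<lambda>x. \<xi> x + \<eta> x)"
  by (auto simp: weakly_measurable_iff_inner inner_add_left intro!: borel_measurable_add)

lemma weakly_measurable_scaleC:
  "weakly_measurable M \<xi> \<Longrightarrow> weakly_measurable M (\<lambda>x. c *\<^sub>C \<xi> x)"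
  by (auto simp: weakly_measurable_iff_inner inner_scaleC_left)

lemma separable_spaceE_dense:
  assumes "separable_space (euclidean :: 'h::topological_space topology)"
  obtains D :: "'h::topological_space set" where "countable D" "closure D = UNIV"
  using assms unfolding separable_space_def by (auto simp: euclidean_closure_of)

text \<open>
  Testing \<open>\<langle>v, d\<rangle> \<le> r * norm d\<close> on a dense set extends by continuity to \<open>d = v\<close>. For a countable
  \<open>D\<close> this turns a condition on the norm into countably many conditions on the scalar functions
  that weak measurability controls.
\<close>

lemma norm_le_iff_dense:
  fixes v :: "'h::real_inner"
  assumes D: "closure D = UNIV" and r: "0 \<le> r"
  shows "norm v \<le> r \<longleftrightarrow> (\<forall>d\<in>D. inner v d \<le> r * norm d)"
proof
  assume "norm v \<le> r"
  then show "\<forall>d\<in>D. inner v d \<le> r * norm d"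
    by (meson mult_right_mono norm_cauchy_schwarz norm_ge_zero order_trans)
next
  assume *: "\<forall>d\<in>D. inner v d \<le> r * norm d"
  have "closed {d. inner v d \<le> r * norm d}"
    by (intro closed_Collect_le continuous_intros)
  then have "closure D \<subseteq> {d. inner v d \<le> r * norm d}"
    using * by (intro closure_minimal) auto
  then have "inner v v \<le> r * norm v" using D by auto
  then have "norm v * norm v \<le> r * norm v" by (simp add: power2_norm_eq_inner[symmetric] power2_eq_square)
  then show "norm v \<le> r" using r
    by (metis mult_right_le_imp_le norm_ge_zero order_le_less)
qed

lemma borel_measurable_norm_weakly:
  fixes \<xi> :: "'a \<Rightarrow> 'h::complex_inner"
  assumes "separable_space (euclidean :: 'h topology)" and \<xi>: "weakly_measurable M \<xi>"
  shows "(\<lambda>x. norm (\<xi> x)) \<in> borel_measurable M"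
proof -
  obtain D :: "'h set" where D: "countable D" "closure D = UNIV"
    using separable_spaceE_dense assms by blast
  have [measurable]: "(\<lambda>x. inner (\<xi> x) d) \<in> borel_measurable M" for d
    using \<xi> by (simp add: weakly_measurable_iff_inner)
  have "{x \<in> space M. norm (\<xi> x) \<le> r} \<in> sets M" for r
  proof (cases "0 \<le> r")
    case True
    have "{x \<in> space M. \<forall>d\<in>D. inner (\<xi> x) d \<le> r * norm d} \<in> sets M"
      using D(1) by measurable
    then show ?thesis
      by (simp add: norm_le_iff_dense[OF D(2) True])
  next
    case False
    then have "norm (\<xi> x) > r" for x by (smt (verit) norm_ge_zero)
    then have "{x \<in> space M. norm (\<xi> x) \<le> r} = {}" by (auto simp: not_le)
    then show ?thesis by (simp only: sets.empty_sets)
  qed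
  then show ?thesis by (simp add: borel_measurable_iff_le)
qed

text \<open>
  Polarization: the pairing of two weakly measurable functions is a combination of squared norms,
  and these are measurable because the sum is again weakly measurable.
\<close>

lemma borel_measurable_inner_weakly:
  fixes \<xi> \<eta> :: "'a \<Rightarrow> 'h::complex_inner"
  assumes sep: "separable_space (euclidean :: 'h topology)"
    and "weakly_measurable M \<xi>" "weakly_measurable M \<eta>"
  shows "(\<lambda>x. inner (\<xi> x) (\<eta> x)) \<in> borel_measurable M"
proof -
  have [measurable]: "(\<lambda>x. norm (\<xi> x + \<eta> x)) \<in> borel_measurable M"
    "(\<lambda>x. norm (\<xi> x)) \<in> borel_measurable M" "(\<lambda>x. norm (\<eta> x)) \<in> borel_measurable M"
    using assms by (auto intro!: borel_measurable_norm_weakly weakly_measurable_add)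
  have "inner (\<xi> x) (\<eta> x) = ((norm (\<xi> x + \<eta> x))\<^sup>2 - (norm (\<xi> x))\<^sup>2 - (norm (\<eta> x))\<^sup>2) / 2" for x
    by (simp add: power2_norm_eq_inner inner_add_left inner_add_right inner_commute)
  then show ?thesis by (simp only:) measurable
qed


text \<open>
  Over a complete measure space, altering a measurable function on a null set keeps it measurable;
  fibrewise projections are identified only almost everywhere, so this is where completeness of
  the measure enters.
\<close>

lemma borel_measurable_AE_complete:
  assumes M: "complete_measure M" and g: "g \<in> borel_measurable M" and AE: "AE x in M. h x = g x"
  shows "h \<in> borel_measurable M"
proof (rule borel_measurableI)
  interpret complete_measure M by fact
  fix S :: "'b::topological_space set" assume "open S"
  then have 1: "g -` S \<inter> space M \<in> sets M"
    using g by (simp add: measurable_sets)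
  have 2: "AE x in M. x \<in> g -` S \<inter> space M \<longleftrightarrow> x \<in> h -` S \<inter> space M"
    using AE by eventually_elim simp
  show "h -` S \<inter> space M \<in> sets M"
    by (rule in_sets_AE[OF 2 1]) simp
qed


section \<open>Square integrable functions\<close>

definition sqnorm :: "'a measure \<Rightarrow> ('a \<Rightarrow> 'h::complex_inner) \<Rightarrow> real"
  where "sqnorm M \<xi> = (LINT x|M. (norm (\<xi> x))\<^sup>2)"

lemma sqnorm_nonneg [simp]: "0 \<le> sqnorm M \<xi>"
  by (simp add: sqnorm_def)

context
  fixes M :: "'a measure"
  assumes sep: "separable_space (euclidean :: 'h::complex_inner topology)"
begin

lemma integrable_inner:
  fixes \<xi> \<eta> :: "'a \<Rightarrow> 'h"
  assumes \<xi>: "\<xi> \<in> square_integrable M" and \<eta>: "\<eta> \<in> square_integrable M"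
  shows "integrable M (\<lambda>x. inner (\<xi> x) (\<eta> x))"
proof (rule Bochner_Integration.integrable_bound)
  show "integrable M (\<lambda>x. (norm (\<xi> x))\<^sup>2 + (norm (\<eta> x))\<^sup>2)"
    using \<xi> \<eta> by (auto simp: square_integrable_def)
  show "(\<lambda>x. inner (\<xi> x) (\<eta> x)) \<in> borel_measurable M"
    using \<xi> \<eta> sep by (auto simp: square_integrable_def borel_measurable_inner_weakly)
  have "norm (inner a b) \<le> norm ((norm a)\<^sup>2 + (norm b)\<^sup>2)" for a b :: 'h
  proof -
    have "\<bar>inner a b\<bar> \<le> norm a * norm b" by (rule Cauchy_Schwarz_ineq2)
    also have "\<dots> \<le> (norm a)\<^sup>2 + (norm b)\<^sup>2"
      using sum_squares_bound[of "norm a" "norm b"] zero_le_power2[of "norm a"] zero_le_power2[of "norm b"]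
        mult_nonneg_nonneg[OF norm_ge_zero[of a] norm_ge_zero[of b]] by linarith
    finally show ?thesis by simp
  qed
  then show "AE x in M. norm (inner (\<xi> x) (\<eta> x)) \<le> norm ((norm (\<xi> x))\<^sup>2 + (norm (\<eta> x))\<^sup>2)"
    by simp
qed

lemma square_integrable_add:
  fixes \<xi> \<eta> :: "'a \<Rightarrow> 'h"
  assumes \<xi>: "\<xi> \<in> square_integrable M" and \<eta>: "\<eta> \<in> square_integrable M"
  shows "(\<lambda>x. \<xi> x + \<eta> x) \<in> square_integrable M"
proof -
  have "integrable M (\<lambda>x. inner (\<xi> x) (\<xi> x) + 2 * inner (\<xi> x) (\<eta> x) + inner (\<eta> x) (\<eta> x))"
    using assms by (intro Bochner_Integration.integrable_add integrable_mult_right integrable_inner)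
  then have "integrable M (\<lambda>x. (norm (\<xi> x + \<eta> x))\<^sup>2)"
    by (simp add: power2_norm_eq_inner inner_add_left inner_add_right inner_commute algebra_simps)
  then show ?thesis
    using assms by (simp add: square_integrable_def weakly_measurable_add)
qed

lemma square_integrable_scaleC:
  fixes \<xi> :: "'a \<Rightarrow> 'h"
  assumes \<xi>: "\<xi> \<in> square_integrable M"
  shows "(\<lambda>x. c *\<^sub>C \<xi> x) \<in> square_integrable M"
  using assms
  by (simp add: square_integrable_def weakly_measurable_scaleC norm_scaleC power_mult_distrib)

lemma square_integrable_scaleR:
  fixes \<xi> :: "'a \<Rightarrow> 'h"
  assumes \<xi>: "\<xi> \<in> square_integrable M"
  shows "(\<lambda>x. r *\<^sub>R \<xi> x) \<in> square_integrable M"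
  using square_integrable_scaleC[OF \<xi>] by (simp add: scaleR_scaleC)

lemma square_integrable_diff:
  fixes \<xi> \<eta> :: "'a \<Rightarrow> 'h"
  assumes \<xi>: "\<xi> \<in> square_integrable M" and \<eta>: "\<eta> \<in> square_integrable M"
  shows "(\<lambda>x. \<xi> x - \<eta> x) \<in> square_integrable M"
  using square_integrable_add[OF \<xi> square_integrable_scaleR[OF \<eta>, of "-1"]] by simp

text \<open>
  With \<open>t = \<plusminus>1\<close> this expansion gives the parallelogram
  law and the Pythagorean theorem, with variable \<open>t\<close> the Cauchy-Schwarz inequality and the
  variational characterization of nearest points.
\<close>

lemma sqnorm_add_scaleR:
  fixes \<xi> \<eta> :: "'a \<Rightarrow> 'h"
  assumes \<xi>: "\<xi> \<in> square_integrable M" and \<eta>: "\<eta> \<in> square_integrable M"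
  shows "sqnorm M (\<lambda>x. \<xi> x + t *\<^sub>R \<eta> x) =
    sqnorm M \<xi> + 2 * t * (LINT x|M. inner (\<xi> x) (\<eta> x)) + t\<^sup>2 * sqnorm M \<eta>"
proof -
  have "sqnorm M (\<lambda>x. \<xi> x + t *\<^sub>R \<eta> x) = 
    (LINT x|M. inner (\<xi> x) (\<xi> x) + (2 * t) * inner (\<xi> x) (\<eta> x) + t\<^sup>2 * inner (\<eta> x) (\<eta> x))"
    unfolding sqnorm_def power2_norm_eq_inner
    by (intro Bochner_Integration.integral_cong refl)
      (simp add: inner_add_left inner_add_right inner_commute power2_eq_square algebra_simps)
  also have "\<dots> = (LINT x|M. inner (\<xi> x) (\<xi> x)) + (2 * t) * (LINT x|M. inner (\<xi> x) (\<eta> x))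
      + t\<^sup>2 * (LINT x|M. inner (\<eta> x) (\<eta> x))"
    using \<xi> \<eta> by (simp add: integrable_inner)
  finally show ?thesis by (simp add: sqnorm_def power2_norm_eq_inner)
qed

lemma sqnorm_eq_0_iff:
  fixes \<xi> :: "'a \<Rightarrow> 'h"
  assumes \<xi>: "\<xi> \<in> square_integrable M"
  shows "sqnorm M \<xi> = 0 \<longleftrightarrow> (AE x in M. \<xi> x = 0)"
  using assms unfolding sqnorm_def square_integrable_def
  by (simp add: integral_nonneg_eq_0_iff_AE)

text \<open>
  Minkowski's inequality follows from the Cauchy-Schwarz inequality for the integrated pairing, that
  is, from the fact that \<open>t \<mapsto> sqnorm M (\<xi> + t \<eta>)\<close> is a nonnegative quadratic polynomial.
\<close>

lemma L2_norm_triangle: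
  fixes \<xi> \<eta> :: "'a \<Rightarrow> 'h"
  assumes \<xi>: "\<xi> \<in> square_integrable M" and \<eta>: "\<eta> \<in> square_integrable M"
  shows "sqrt (sqnorm M (\<lambda>x. \<xi> x + \<eta> x)) \<le> sqrt (sqnorm M \<xi>) + sqrt (sqnorm M \<eta>)"
proof -
  let ?c = "LINT x|M. inner (\<xi> x) (\<eta> x)"
  let ?a = "sqnorm M \<xi>" and ?b = "sqnorm M \<eta>"
  have q: "0 \<le> ?a + 2 * t * ?c + t\<^sup>2 * ?b" for t
    using sqnorm_add_scaleR[OF \<xi> \<eta>, of t] sqnorm_nonneg by metis
  have "?c\<^sup>2 \<le> ?a * ?b"
  proof (cases "?b = 0")
    case True
    have "?c = 0"
    proof (rule ccontr)
      assume "?c \<noteq> 0"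
      then show False
        using q[of "- (?a + 1) / (2 * ?c)"] True by (simp add: field_simps)
    qed
    then show ?thesis by simp
  next
    case False
    then have "?b > 0" by (metis order_le_less sqnorm_nonneg)
    then show ?thesis
      using q[of "- ?c / ?b"] by (simp add: field_simps power2_eq_square)
  qed
  then have "\<bar>?c\<bar> \<le> sqrt ?a * sqrt ?b"
    by (metis real_sqrt_abs real_sqrt_le_iff real_sqrt_mult)
  then have "sqnorm M (\<lambda>x. \<xi> x + \<eta> x) \<le> (sqrt ?a + sqrt ?b)\<^sup>2"
    using sqnorm_add_scaleR[OF \<xi> \<eta>, of 1] by (simp add: power2_sum)
  then show ?thesis
    by (simp add: real_le_lsqrt)
qed

lemma sqnorm_cong_AE:
  fixes \<xi> \<eta> :: "'a \<Rightarrow> 'h"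
  assumes \<xi>: "\<xi> \<in> square_integrable M" and \<eta>: "\<eta> \<in> square_integrable M"
    and "AE x in M. \<xi> x = \<eta> x"
  shows "sqnorm M \<xi> = sqnorm M \<eta>"
  unfolding sqnorm_def
  by (rule integral_cong_AE) (use assms in \<open>auto simp: square_integrable_def dest: borel_measurable_integrable\<close>)

end


section \<open>Completeness and orthogonal projection\<close>

instance complex_hilbert \<subseteq> banach ..

lemma sqnorm_eq_nn_integral:
  "integrable M (\<lambda>x. (norm (\<xi> x))\<^sup>2) \<Longrightarrow> ennreal (sqnorm M \<xi>) = (\<integral>\<^sup>+x. (norm (\<xi> x))\<^sup>2 \<partial>M)"
  unfolding sqnorm_def by (rule nn_integral_eq_integral[symmetric]) auto

text \<open>
  The inequality \<open>s \<le> b s\<^sup>2 + 1 / b\<close> with \<open>b = 2 ^ n\<close> trades the weights for summability of the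
  increments themselves.
\<close>

lemma convergent_of_weighted_summable:
  fixes u :: "nat \<Rightarrow> 'h::banach"
  assumes "summable (\<lambda>n. 2 ^ n * (norm (u (Suc n) - u n))\<^sup>2)"
  shows "convergent u"
proof -
  have "summable (\<lambda>n. u (Suc n) - u n)"
  proof (rule summable_comparison_test')
    show "summable (\<lambda>n. 2 ^ n * (norm (u (Suc n) - u n))\<^sup>2 + (1/2) ^ n)"
      by (intro summable_add assms summable_geometric) simp
    fix n :: nat
    have "s \<le> b * s\<^sup>2 + 1 / b" if "b > 0" "s \<ge> 0" for s b :: real
    proof -
      have "0 \<le> (b * s - 1)\<^sup>2" by simp
      then have "2 * s * b \<le> (b * s)\<^sup>2 + 1"
        by (simp add: power2_diff mult_ac)
      also have "\<dots> = (b * s\<^sup>2 + 1 / b) * b"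
        using that by (simp add: power2_eq_square field_simps)
      finally have "2 * s * b \<le> (b * s\<^sup>2 + 1 / b) * b" .
      then have "2 * s \<le> b * s\<^sup>2 + 1 / b" using that by simp
      then show ?thesis using that by simp
    qed
    then show "norm (u (Suc n) - u n) \<le> 2 ^ n * (norm (u (Suc n) - u n))\<^sup>2 + (1/2) ^ n"
      by (simp add: power_one_over)
  qed
  then have "convergent (\<lambda>n. u 0 + (\<Sum>k<n. u (Suc k) - u k))"
    using convergent_def summable_LIMSEQ tendsto_add tendsto_const by blast
  then show ?thesis
    by (simp add: sum_lessThan_telescope)
qed

text \<open>
  By monotone convergence the sum of the functions has a finite integral, so it is finite
  almost everywhere.
\<close>

lemma AE_summable_of_summable_integrals:
  fixes h :: "nat \<Rightarrow> 'a \<Rightarrow> real"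
  assumes int: "\<And>n. integrable M (h n)" and nonneg: "\<And>n x. 0 \<le> h n x"
    and summable: "summable (\<lambda>n. LINT x|M. h n x)"
  shows "AE x in M. summable (\<lambda>n. h n x)"
proof -
  have [measurable]: "h n \<in> borel_measurable M" for n
    using int by blast
  have "(\<integral>\<^sup>+x. (\<Sum>n. ennreal (h n x)) \<partial>M) = (\<Sum>n. (\<integral>\<^sup>+x. ennreal (h n x) \<partial>M))"
    by (rule nn_integral_suminf) measurable
  also have "\<dots> = (\<Sum>n. ennreal (LINT x|M. h n x))"
    by (subst nn_integral_eq_integral) (simp_all add: int nonneg)
  also have "\<dots> = ennreal (\<Sum>n. LINT x|M. h n x)"
    by (intro suminf_ennreal2 summable) (simp add: nonneg)
  also have "\<dots> < \<infinity>" by simp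
  finally have "AE x in M. (\<Sum>n. ennreal (h n x)) \<noteq> \<infinity>"
    by (intro nn_integral_PInf_AE) auto
  then show ?thesis
  proof eventually_elim
    case (elim x)
    then show ?case by (intro summable_suminf_not_top) (simp_all add: nonneg)
  qed
qed

text \<open>
  The rate \<open>(1/4) ^ n\<close> leaves room for the weight \<open>2 ^ n\<close>: the weighted square increments still have
  summable integrals, and the weight makes the increments themselves summable pointwise.
\<close>

lemma L2_Cauchy_AE_convergent:
  fixes g :: "nat \<Rightarrow> 'a \<Rightarrow> 'h::complex_hilbert"
  assumes sep: "separable_space (euclidean :: 'h topology)"
    and g: "\<And>n. g n \<in> square_integrable M"
    and cau: "\<And>n. sqnorm M (\<lambda>x. g (Suc n) x - g n x) \<le> (1/4) ^ n"
  shows "AE x in M. convergent (\<lambda>n. g n x)"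
proof -
  let ?h = "\<lambda>n x. 2 ^ n * (norm (g (Suc n) x - g n x))\<^sup>2"
  have "AE x in M. summable (\<lambda>n. ?h n x)"
  proof (rule AE_summable_of_summable_integrals)
    show "integrable M (?h n)" for n
      using square_integrable_diff[OF sep g[of "Suc n"] g[of n]] by (simp add: square_integrable_def)
    show "summable (\<lambda>n. LINT x|M. ?h n x)"
    proof (rule summable_comparison_test')
      show "summable (\<lambda>n. (1/2 :: real) ^ n)" by (rule summable_geometric) simp
      fix n :: nat
      have "2 ^ n * sqnorm M (\<lambda>x. g (Suc n) x - g n x) \<le> 2 ^ n * (1/4) ^ n"
        by (intro mult_left_mono cau) simp
      also have "\<dots> = (1/2) ^ n" by (simp flip: power_mult_distrib)
      finally show "norm (LINT x|M. ?h n x) \<le> (1/2) ^ n"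
        by (simp add: sqnorm_def)
    qed
  qed simp
  then show ?thesis
    by eventually_elim (rule convergent_of_weighted_summable)
qed

text \<open>
  If the square distances of an approximating sequence to \<open>\<xi>\<close> are summable, then for almost every \<open>x\<close>
  the squares \<open>(norm (\<xi> x - u n x))\<^sup>2\<close> are summable as well, hence tend to zero.
\<close>

lemma AE_in_closure_of_L2_approximation:
  fixes \<xi> :: "'a \<Rightarrow> 'h::complex_inner"
  assumes sep: "separable_space (euclidean :: 'h topology)"
    and C: "C \<subseteq> square_integrable M" and \<xi>: "\<xi> \<in> square_integrable M"
    and approx: "\<And>e. e > 0 \<Longrightarrow> \<exists>\<eta>\<in>C. sqnorm M (\<lambda>x. \<xi> x - \<eta> x) < e"
  shows "AE x in M. \<xi> x \<in> closure ((\<lambda>\<eta>. \<eta> x) ` C)"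
proof -
  have "\<exists>\<eta>\<in>C. sqnorm M (\<lambda>x. \<xi> x - \<eta> x) < (1/2) ^ n" for n :: nat
    by (rule approx) simp
  then obtain u where uC: "\<And>n. u n \<in> C" and u: "\<And>n. sqnorm M (\<lambda>x. \<xi> x - u n x) < (1/2) ^ n"
    by metis
  have "AE x in M. summable (\<lambda>n. (norm (\<xi> x - u n x))\<^sup>2)"
  proof (rule AE_summable_of_summable_integrals)
    show "integrable M (\<lambda>x. (norm (\<xi> x - u n x))\<^sup>2)" for n
      using square_integrable_diff[OF sep \<xi>, of "u n"] uC C by (auto simp: square_integrable_def)
    show "summable (\<lambda>n. LINT x|M. (norm (\<xi> x - u n x))\<^sup>2)"
    proof (rule summable_comparison_test')
      show "summable (\<lambda>n. (1/2 :: real) ^ n)" by (rule summable_geometric) simp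
      show "norm (LINT x|M. (norm (\<xi> x - u n x))\<^sup>2) \<le> (1/2) ^ n" for n
        using u[of n] by (simp add: sqnorm_def)
    qed
  qed simp
  then show ?thesis
  proof eventually_elim
    case (elim x)
    then have "(\<lambda>n. sqrt ((norm (\<xi> x - u n x))\<^sup>2)) \<longlonglongrightarrow> sqrt 0"
      by (intro tendsto_real_sqrt summable_LIMSEQ_zero)
    then have "(\<lambda>n. norm (u n x - \<xi> x)) \<longlonglongrightarrow> 0"
      by (simp add: norm_minus_commute)
    then have "(\<lambda>n. u n x) \<longlonglongrightarrow> \<xi> x"
      by (simp add: LIM_zero_iff tendsto_norm_zero_iff)
    then show ?case
      using uC unfolding closure_sequential by (intro exI[of _ "\<lambda>n. u n x"]) auto
  qed
qed

text \<open>
  Completeness of the space of square integrable functions, for sequences that are Cauchy at a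
  geometric rate: the sequence converges almost everywhere, the pointwise limit is weakly measurable
  as a limit of measurable scalar functions, and Fatou's lemma transfers the bound on
  \<open>sqnorm M (g m - g n)\<close> to the limit \<open>m \<rightarrow> \<infinity>\<close>.
\<close>

lemma L2_Cauchy_limit:
  fixes g :: "nat \<Rightarrow> 'a \<Rightarrow> 'h::complex_hilbert"
  assumes sep: "separable_space (euclidean :: 'h topology)"
    and g: "\<And>n. g n \<in> square_integrable M"
    and cau: "\<And>m n. n \<le> m \<Longrightarrow> sqnorm M (\<lambda>x. g m x - g n x) \<le> (1/4) ^ n"
  obtains \<xi> where "\<xi> \<in> square_integrable M" "\<And>n. sqnorm M (\<lambda>x. \<xi> x - g n x) \<le> (1/4) ^ n"
proof -
  have "AE x in M. convergent (\<lambda>n. g n x)"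
    using L2_Cauchy_AE_convergent[OF sep g] cau[of n "Suc n" for n] by simp
  then obtain N where N: "\<And>x. x \<in> space M - N \<Longrightarrow> convergent (\<lambda>n. g n x)" "N \<in> null_sets M"
    by (rule AE_E3) blast
  \<comment> \<open>The value \<open>0\<close> on the measurable null set \<open>N\<close> makes \<open>\<xi>\<close> an everywhere limit of measurable functions.\<close>
  define \<xi> where "\<xi> x = (if x \<in> N then 0 else lim (\<lambda>n. g n x))" for x
  have lim: "(\<lambda>n. g n x) \<longlonglongrightarrow> \<xi> x" if "x \<in> space M" "x \<notin> N" for x
    using N(1)[of x] that by (simp add: \<xi>_def convergent_LIMSEQ_iff)
  have AE_N: "AE x in M. x \<notin> N" using N(2) by (rule AE_not_in)
  have wg: "weakly_measurable M (g n)" for n using g by (simp add: square_integrable_def)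
  have w\<xi>: "weakly_measurable M \<xi>"
    unfolding weakly_measurable_iff_inner
  proof
    fix a
    have [measurable]: "N \<in> sets M" using N(2) by auto
    have [measurable]: "(\<lambda>x. inner (g n x) a) \<in> borel_measurable M" for n
      using wg by (simp add: weakly_measurable_iff_inner)
    show "(\<lambda>x. inner (\<xi> x) a) \<in> borel_measurable M"
    proof (rule borel_measurable_LIMSEQ_real)
      show "(\<lambda>n. if x \<in> N then 0 else inner (g n x) a) \<longlonglongrightarrow> inner (\<xi> x) a" if "x \<in> space M" for x
        using lim[OF that] by (cases "x \<in> N") (auto simp: \<xi>_def intro!: tendsto_intros)
      show "(\<lambda>x. if x \<in> N then 0 else inner (g n x) a) \<in> borel_measurable M" for n
        by measurable
    qed
  qed
  have wd: "weakly_measurable M (\<lambda>x. \<xi> x - g n x)" for n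
    using weakly_measurable_add[OF w\<xi> weakly_measurable_scaleC[OF wg[of n], of "-1"]]
    by (simp add: weakly_measurable_iff_inner inner_diff_left inner_add_left inner_scaleC_left
        complex_vector.scale_minus_left)
  have [measurable]: "(\<lambda>x. (norm (g m x - g n x))\<^sup>2) \<in> borel_measurable M" for m n
    using square_integrable_diff[OF sep g[of m] g[of n]]
    by (auto simp: square_integrable_def dest: borel_measurable_integrable)
  have [measurable]: "(\<lambda>x. norm (\<xi> x - g n x)) \<in> borel_measurable M" for n
    using sep wd by (rule borel_measurable_norm_weakly)
  have bnd: "(\<integral>\<^sup>+x. (norm (\<xi> x - g n x))\<^sup>2 \<partial>M) \<le> ennreal ((1/4) ^ n)" for n
  proof -
    have "(\<integral>\<^sup>+x. (norm (\<xi> x - g n x))\<^sup>2 \<partial>M)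
        = (\<integral>\<^sup>+x. liminf (\<lambda>m. ennreal ((norm (g m x - g n x))\<^sup>2)) \<partial>M)"
    proof (rule nn_integral_cong_AE, use AE_N AE_space in eventually_elim)
      case (elim x)
      have "(\<lambda>m. ennreal ((norm (g m x - g n x))\<^sup>2)) \<longlonglongrightarrow> ennreal ((norm (\<xi> x - g n x))\<^sup>2)"
        using lim elim by (intro tendsto_ennrealI tendsto_intros) auto
      then show ?case by (rule lim_imp_Liminf[OF trivial_limit_sequentially, symmetric])
    qed
    also have "\<dots> \<le> liminf (\<lambda>m. \<integral>\<^sup>+x. (norm (g m x - g n x))\<^sup>2 \<partial>M)"
      by (rule nn_integral_liminf) measurable
    also have "\<dots> \<le> liminf (\<lambda>m. ennreal ((1/4) ^ n))"
    proof (rule Liminf_mono)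
      show "\<forall>\<^sub>F m in sequentially. (\<integral>\<^sup>+x. (norm (g m x - g n x))\<^sup>2 \<partial>M) \<le> ennreal ((1/4) ^ n)"
        using eventually_ge_at_top[of n]
      proof eventually_elim
        case (elim m)
        then show ?case
          using square_integrable_diff[OF sep g[of m] g[of n]] cau[OF elim]
          by (subst sqnorm_eq_nn_integral[symmetric]) (auto simp: square_integrable_def intro: ennreal_leI)
      qed
    qed
    also have "\<dots> = ennreal ((1/4) ^ n)" by (simp add: Liminf_const)
    finally show ?thesis .
  qed
  have d: "(\<lambda>x. \<xi> x - g n x) \<in> square_integrable M" for n
    using wd[of n] bnd[of n] unfolding square_integrable_def
    by (auto intro!: integrableI_nonneg elim: order_le_less_trans)
  have "sqnorm M (\<lambda>x. \<xi> x - g n x) \<le> (1/4) ^ n" for n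
  proof -
    have "ennreal (sqnorm M (\<lambda>x. \<xi> x - g n x)) \<le> ennreal ((1/4) ^ n)"
      using bnd[of n] d[of n] by (subst sqnorm_eq_nn_integral) (simp_all add: square_integrable_def)
    then show ?thesis by (subst (asm) ennreal_le_iff) simp_all
  qed
  moreover have "\<xi> \<in> square_integrable M"
    using square_integrable_add[OF sep d[of 0] g[of 0]] by simp
  ultimately show thesis using that by blast
qed

text \<open>
  The algebra behind the variational argument: a quadratic polynomial without constant term that is
  nowhere negative has no linear term.
\<close>

lemma linear_coefficient_zero:
  fixes b c :: real
  assumes "\<And>t. 0 \<le> 2 * t * c + t\<^sup>2 * b" and "0 \<le> b"
  shows "c = 0"
proof (rule ccontr)
  assume "c \<noteq> 0"
  define t where "t = - c / (b + 1)"
  have t: "c = - t * (b + 1)" "t \<noteq> 0"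
    using assms(2) \<open>c \<noteq> 0\<close> by (auto simp: t_def)
  have "2 * t * c + t\<^sup>2 * b = - (t\<^sup>2 * (b + 2))"
    by (simp add: t(1) power2_eq_square algebra_simps)
  moreover have "t\<^sup>2 * (b + 2) > 0"
    using t(2) assms(2) by simp
  ultimately show False using assms(1)[of t] by simp
qed

text \<open>
  The classical argument in Hilbert space: by the parallelogram law a sufficiently good minimizing
  sequence is Cauchy, because midpoints stay in \<open>V\<close> and cannot do better than the infimum.
  Closedness of \<open>V\<close> is expressed by approximation in the square norm.
\<close>

lemma L2_nearest_point:
  fixes \<xi> :: "'a \<Rightarrow> 'h::complex_hilbert"
  assumes sep: "separable_space (euclidean :: 'h topology)"
    and V: "V \<subseteq> square_integrable M" "V \<noteq> {}"
    and midpoint: "\<And>\<eta> \<zeta>. \<eta> \<in> V \<Longrightarrow> \<zeta> \<in> V \<Longrightarrow> (\<lambda>x. (1/2) *\<^sub>R (\<eta> x + \<zeta> x)) \<in> V"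
    and closed: "\<And>\<zeta>. \<zeta> \<in> square_integrable M \<Longrightarrow>
      (\<And>e. e > 0 \<Longrightarrow> \<exists>\<eta>\<in>V. sqnorm M (\<lambda>x. \<zeta> x - \<eta> x) < e) \<Longrightarrow> \<zeta> \<in> V"
    and \<xi>: "\<xi> \<in> square_integrable M"
  obtains p where "p \<in> V" "\<And>\<eta>. \<eta> \<in> V \<Longrightarrow> sqnorm M (\<lambda>x. \<xi> x - p x) \<le> sqnorm M (\<lambda>x. \<xi> x - \<eta> x)"
proof -
  define d where "d = (INF \<eta>\<in>V. sqnorm M (\<lambda>x. \<xi> x - \<eta> x))"
  have bdd: "bdd_below ((\<lambda>\<eta>. sqnorm M (\<lambda>x. \<xi> x - \<eta> x)) ` V)"
    by (rule bdd_belowI2[of _ 0]) simp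
  have d_le: "d \<le> sqnorm M (\<lambda>x. \<xi> x - \<eta> x)" if "\<eta> \<in> V" for \<eta>
    unfolding d_def by (rule cINF_lower[OF bdd that])
  have "\<exists>\<eta>\<in>V. sqnorm M (\<lambda>x. \<xi> x - \<eta> x) < d + (1/4) ^ n / 4" for n :: nat
    using cINF_less_iff[OF V(2) bdd, of "d + (1/4) ^ n / 4"] by (simp add: d_def)
  then obtain g where gV: "\<And>n. g n \<in> V"
    and g_near: "\<And>n. sqnorm M (\<lambda>x. \<xi> x - g n x) < d + (1/4) ^ n / 4"
    by metis
  have g: "g n \<in> square_integrable M" for n using gV V by blast
  have cau: "sqnorm M (\<lambda>x. g m x - g n x) \<le> (1/4) ^ n" if "n \<le> m" for m n
  proof -
    \<comment> \<open>The parallelogram with sides \<open>?u\<close> and \<open>?v\<close>: one diagonal is \<open>g m - g n\<close>, the other one twice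
      the distance vector from \<open>\<xi>\<close> to a midpoint.\<close>
    let ?u = "\<lambda>x. \<xi> x - g n x" and ?v = "\<lambda>x. \<xi> x - g m x"
    have u: "?u \<in> square_integrable M" and v: "?v \<in> square_integrable M"
      by (auto intro!: square_integrable_diff sep \<xi> g)
    have "d \<le> sqnorm M (\<lambda>x. \<xi> x - (1/2) *\<^sub>R (g n x + g m x))"
      by (intro d_le midpoint gV)
    also have "\<dots> = sqnorm M (\<lambda>x. (1/2) *\<^sub>R (?u x + ?v x))"
      by (rule arg_cong[of _ _ "sqnorm M"]) (auto simp: fun_eq_iff algebra_simps simp flip: scaleR_2)
    also have "\<dots> = sqnorm M (\<lambda>x. ?u x + ?v x) / 4"
      by (simp add: sqnorm_def power_divide)
    finally have "4 * d \<le> sqnorm M (\<lambda>x. ?u x + ?v x)" by simp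
    moreover have "sqnorm M (\<lambda>x. ?u x - ?v x) + sqnorm M (\<lambda>x. ?u x + ?v x)
        = 2 * sqnorm M ?u + 2 * sqnorm M ?v"
      using sqnorm_add_scaleR[OF sep u v, of 1] sqnorm_add_scaleR[OF sep u v, of "-1"] by simp
    moreover have "(1/4) ^ m \<le> (1/4 :: real) ^ n"
      using that by (intro power_decreasing) auto
    moreover have "sqnorm M (\<lambda>x. ?u x - ?v x) = sqnorm M (\<lambda>x. g m x - g n x)"
      by simp
    ultimately show ?thesis using g_near[of n] g_near[of m] by linarith
  qed
  obtain p where p: "p \<in> square_integrable M" "\<And>n. sqnorm M (\<lambda>x. p x - g n x) \<le> (1/4) ^ n"
    using L2_Cauchy_limit[OF sep g cau] by blast
  have lim0: "(\<lambda>n. (1/4 :: real) ^ n) \<longlonglongrightarrow> 0" by (rule LIMSEQ_power_zero) simp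
  have pV: "p \<in> V"
  proof (rule closed[OF p(1)])
    fix e :: real assume "e > 0"
    then obtain n where "(1/4) ^ n < e"
      using real_arch_pow_inv[of e "1/4"] by auto
    then show "\<exists>\<eta>\<in>V. sqnorm M (\<lambda>x. p x - \<eta> x) < e"
      using p(2)[of n] gV[of n] by (meson order_le_less_trans)
  qed
  have "sqrt (sqnorm M (\<lambda>x. \<xi> x - p x)) \<le> sqrt d"
  proof (rule LIMSEQ_le_const)
    show "(\<lambda>n. sqrt (d + (1/4) ^ n / 4) + sqrt ((1/4) ^ n)) \<longlonglongrightarrow> sqrt d"
      using lim0 by (auto intro!: tendsto_eq_intros)
    have "sqrt (sqnorm M (\<lambda>x. \<xi> x - p x)) \<le> sqrt (d + (1/4) ^ n / 4) + sqrt ((1/4) ^ n)" for n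
    proof -
      have "sqrt (sqnorm M (\<lambda>x. (\<xi> x - g n x) + (g n x - p x)))
          \<le> sqrt (sqnorm M (\<lambda>x. \<xi> x - g n x)) + sqrt (sqnorm M (\<lambda>x. g n x - p x))"
        by (intro L2_norm_triangle square_integrable_diff sep \<xi> g p)
      also have "\<dots> \<le> sqrt (d + (1/4) ^ n / 4) + sqrt ((1/4) ^ n)"
        using g_near[of n] p(2)[of n]
        by (intro add_mono real_sqrt_le_mono) (simp_all add: sqnorm_def norm_minus_commute)
      finally show ?thesis by simp
    qed
    then show "\<exists>N. \<forall>n\<ge>N. sqrt (sqnorm M (\<lambda>x. \<xi> x - p x)) \<le> sqrt (d + (1/4) ^ n / 4) + sqrt ((1/4) ^ n)"
      by blast
  qed
  then have "sqnorm M (\<lambda>x. \<xi> x - p x) \<le> sqnorm M (\<lambda>x. \<xi> x - \<eta> x)" if "\<eta> \<in> V" for \<eta>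
    using d_le[OF that] by simp
  then show thesis using that pV by blast
qed

text \<open>
  The nearest point \<open>p\<close> is characterized by orthogonality: moving from \<open>p\<close> along \<open>\<eta>\<close> cannot decrease
  the distance to \<open>\<xi>\<close>, so the linear term of the square distance vanishes.
\<close>

lemma L2_projection_exists:
  fixes \<xi> :: "'a \<Rightarrow> 'h::complex_hilbert"
  assumes sep: "separable_space (euclidean :: 'h topology)"
    and V: "V \<subseteq> square_integrable M" "V \<noteq> {}"
    and add: "\<And>\<eta> \<zeta>. \<eta> \<in> V \<Longrightarrow> \<zeta> \<in> V \<Longrightarrow> (\<lambda>x. \<eta> x + \<zeta> x) \<in> V"
    and scale: "\<And>r \<eta>. \<eta> \<in> V \<Longrightarrow> (\<lambda>x. r *\<^sub>R \<eta> x) \<in> V"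
    and closed: "\<And>\<zeta>. \<zeta> \<in> square_integrable M \<Longrightarrow>
      (\<And>e. e > 0 \<Longrightarrow> \<exists>\<eta>\<in>V. sqnorm M (\<lambda>x. \<zeta> x - \<eta> x) < e) \<Longrightarrow> \<zeta> \<in> V"
    and \<xi>: "\<xi> \<in> square_integrable M"
  obtains p where "p \<in> V" "\<And>\<eta>. \<eta> \<in> V \<Longrightarrow> (LINT x|M. inner (\<xi> x - p x) (\<eta> x)) = 0"
proof -
  obtain p where p: "p \<in> V"
    and min: "\<And>\<eta>. \<eta> \<in> V \<Longrightarrow> sqnorm M (\<lambda>x. \<xi> x - p x) \<le> sqnorm M (\<lambda>x. \<xi> x - \<eta> x)"
    using L2_nearest_point[OF sep V scale[OF add] closed \<xi>] by blast
  have "(LINT x|M. inner (\<xi> x - p x) (\<eta> x)) = 0" if \<eta>: "\<eta> \<in> V" for \<eta>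
  proof (rule linear_coefficient_zero[where b = "sqnorm M \<eta>"])
    fix t
    have "sqnorm M (\<lambda>x. \<xi> x - p x) \<le> sqnorm M (\<lambda>x. \<xi> x - (p x + (- t) *\<^sub>R \<eta> x))"
      by (intro min add p scale \<eta>)
    also have "\<dots> = sqnorm M (\<lambda>x. (\<xi> x - p x) + t *\<^sub>R \<eta> x)"
      by (simp add: algebra_simps)
    also have "\<dots> = sqnorm M (\<lambda>x. \<xi> x - p x) + 2 * t * (LINT x|M. inner (\<xi> x - p x) (\<eta> x))
        + t\<^sup>2 * sqnorm M \<eta>"
      using V p \<eta> by (intro sqnorm_add_scaleR square_integrable_diff sep \<xi>) auto
    finally show "0 \<le> 2 * t * (LINT x|M. inner (\<xi> x - p x) (\<eta> x)) + t\<^sup>2 * sqnorm M \<eta>" by simp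
  qed simp
  then show thesis using that p by blast
qed


section \<open>Equivalence classes and their representatives\<close>

lemma equiv_ae_eq_rel: "equiv (square_integrable M) (ae_eq_rel M)"
  proof (rule equivI)
  show "ae_eq_rel M \<subseteq> square_integrable M \<times> square_integrable M"
    by (auto simp: ae_eq_rel_def)
  show "refl_on (square_integrable M) (ae_eq_rel M)"
    by (rule refl_onI) (simp add: ae_eq_rel_def)
  show "sym (ae_eq_rel M)"
  proof (rule symI)
    fix \<xi> \<eta>
    assume *: "(\<xi>, \<eta>) \<in> ae_eq_rel M"
    then have "AE x in M. \<xi> x = \<eta> x" by (simp add: ae_eq_rel_def)
    then have "AE x in M. \<eta> x = \<xi> x" by eventually_elim simp
    with * show "(\<eta>, \<xi>) \<in> ae_eq_rel M" by (simp add: ae_eq_rel_def)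
  qed
  show "trans (ae_eq_rel M)"
  proof (rule transI)
    fix \<xi> \<eta> \<zeta>
    assume *: "(\<xi>, \<eta>) \<in> ae_eq_rel M" "(\<eta>, \<zeta>) \<in> ae_eq_rel M"
    then have "AE x in M. \<xi> x = \<eta> x" "AE x in M. \<eta> x = \<zeta> x"
      by (simp_all add: ae_eq_rel_def)
    then have "AE x in M. \<xi> x = \<zeta> x" by eventually_elim simp
    with * show "(\<xi>, \<zeta>) \<in> ae_eq_rel M" by (simp add: ae_eq_rel_def)
  qed
qed

lemma L2_class_in_L2: "\<xi> \<in> square_integrable M \<Longrightarrow> L2_class M \<xi> \<in> L2 M"
  by (simp add: L2_def L2_class_def quotientI)

lemma L2_class_cong:
  assumes "\<xi> \<in> square_integrable M" "\<eta> \<in> square_integrable M" "AE x in M. \<xi> x = \<eta> x"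
  shows "L2_class M \<xi> = L2_class M \<eta>"
  unfolding L2_class_def
  by (rule equiv_class_eq[OF equiv_ae_eq_rel]) (use assms in \<open>simp add: ae_eq_rel_def\<close>)

lemma mem_L2_class:
  assumes "F \<in> L2 M" "\<xi> \<in> F"
  shows "\<xi> \<in> square_integrable M" "L2_class M \<xi> = F"
proof -
  obtain \<eta> where \<eta>: "\<eta> \<in> square_integrable M" "F = L2_class M \<eta>"
    using assms(1) unfolding L2_def L2_class_def by (rule quotientE)
  then have "(\<eta>, \<xi>) \<in> ae_eq_rel M" using assms(2) by (simp add: L2_class_def)
  then show "\<xi> \<in> square_integrable M" "L2_class M \<xi> = F"
    using \<eta>(2) L2_class_cong[of \<eta> M \<xi>] by (auto simp: ae_eq_rel_def)
qed

lemma L2_rep_in: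
  assumes "F \<in> L2 M"
  shows "L2_rep F \<in> F"
proof -
  have "F \<noteq> {}"
    using assms equiv_ae_eq_rel unfolding L2_def by (rule in_quotient_imp_non_empty[rotated])
  then show ?thesis unfolding L2_rep_def by (simp add: some_in_eq)
qed

lemma L2_rep_square_integrable: "F \<in> L2 M \<Longrightarrow> L2_rep F \<in> square_integrable M"
  using mem_L2_class(1) L2_rep_in by blast

lemma L2_class_L2_rep: "F \<in> L2 M \<Longrightarrow> L2_class M (L2_rep F) = F"
  using mem_L2_class(2) L2_rep_in by blast

lemma AE_eq_of_L2_class_eq:
  assumes "L2_class M \<xi> = L2_class M \<eta>" "\<eta> \<in> square_integrable M"
  shows "AE x in M. \<xi> x = \<eta> x"
proof -
  have "\<eta> \<in> L2_class M \<eta>"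
    using assms(2) by (simp add: L2_class_def ae_eq_rel_def)
  then show ?thesis
    using assms(1) by (auto simp: L2_class_def ae_eq_rel_def)
qed

lemma L2_rep_L2_class_AE:
  assumes "\<xi> \<in> square_integrable M"
  shows "AE x in M. L2_rep (L2_class M \<xi>) x = \<xi> x"
  using AE_eq_of_L2_class_eq[OF L2_class_L2_rep[OF L2_class_in_L2[OF assms]] assms] .

lemma L2_dist_conv_sqnorm: "L2_dist M F G = sqrt (sqnorm M (\<lambda>x. L2_rep F x - L2_rep G x))"
  by (simp add: L2_dist_def sqnorm_def)

context
  fixes M :: "'a measure"
  assumes sep: "separable_space (euclidean :: 'h::complex_inner topology)"
begin

lemma Metric_space_L2: "Metric_space (L2 M :: ('a \<Rightarrow> 'h) set set) (L2_dist M)"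
proof
  fix F G H :: "('a \<Rightarrow> 'h) set"
  show "0 \<le> L2_dist M F G" by (simp add: L2_dist_conv_sqnorm)
  show "L2_dist M F G = L2_dist M G F"
    by (simp add: L2_dist_conv_sqnorm sqnorm_def norm_minus_commute)
  assume F: "F \<in> L2 M" and G: "G \<in> L2 M"
  note reps = L2_rep_square_integrable[OF F] L2_rep_square_integrable[OF G]
  have "sqnorm M (\<lambda>x. L2_rep F x - L2_rep G x) = 0 \<longleftrightarrow> (AE x in M. L2_rep F x = L2_rep G x)"
    using sqnorm_eq_0_iff[OF sep square_integrable_diff[OF sep reps]] by simp
  also have "\<dots> \<longleftrightarrow> F = G"
    using L2_class_cong[OF reps] L2_class_L2_rep[OF F] L2_class_L2_rep[OF G] by auto
  finally show "L2_dist M F G = 0 \<longleftrightarrow> F = G"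
    by (simp add: L2_dist_conv_sqnorm)
  assume H: "H \<in> L2 M"
  have "sqrt (sqnorm M (\<lambda>x. (L2_rep F x - L2_rep G x) + (L2_rep G x - L2_rep H x)))
      \<le> L2_dist M F G + L2_dist M G H"
    unfolding L2_dist_conv_sqnorm
    by (intro L2_norm_triangle square_integrable_diff sep L2_rep_square_integrable F G H)
  then show "L2_dist M F H \<le> L2_dist M F G + L2_dist M G H"
    by (simp add: L2_dist_conv_sqnorm)
qed

lemma L2_dist_L2_class:
  fixes \<xi> \<eta> :: "'a \<Rightarrow> 'h"
  assumes \<xi>: "\<xi> \<in> square_integrable M" and \<eta>: "\<eta> \<in> square_integrable M"
  shows "L2_dist M (L2_class M \<xi>) (L2_class M \<eta>) = sqrt (sqnorm M (\<lambda>x. \<xi> x - \<eta> x))"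
proof -
  note \<xi>' = L2_rep_square_integrable[OF L2_class_in_L2[OF \<xi>]]
    and \<eta>' = L2_rep_square_integrable[OF L2_class_in_L2[OF \<eta>]]
  have "AE x in M. L2_rep (L2_class M \<xi>) x - L2_rep (L2_class M \<eta>) x = \<xi> x - \<eta> x"
    using L2_rep_L2_class_AE[OF \<xi>] L2_rep_L2_class_AE[OF \<eta>] by eventually_elim simp
  then have "sqnorm M (\<lambda>x. L2_rep (L2_class M \<xi>) x - L2_rep (L2_class M \<eta>) x)
      = sqnorm M (\<lambda>x. \<xi> x - \<eta> x)"
    by (intro sqnorm_cong_AE square_integrable_diff sep \<xi> \<eta> \<xi>' \<eta>')
  then show ?thesis by (simp add: L2_dist_conv_sqnorm)
qed

lemma integral_cinner:
  fixes \<xi> \<eta> :: "'a \<Rightarrow> 'h"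
  assumes \<xi>: "\<xi> \<in> square_integrable M" and \<eta>: "\<eta> \<in> square_integrable M"
  shows "(LINT x|M. cinner (\<xi> x) (\<eta> x)) =
    Complex (LINT x|M. inner (\<xi> x) (\<eta> x)) (LINT x|M. inner (\<xi> x) (\<i> *\<^sub>C \<eta> x))"
proof -
  have int: "integrable M (\<lambda>x. inner (\<xi> x) (\<eta> x))" "integrable M (\<lambda>x. inner (\<xi> x) (\<i> *\<^sub>C \<eta> x))"
    by (intro integrable_inner sep \<xi> \<eta> square_integrable_scaleC)+
  have "(LINT x|M. cinner (\<xi> x) (\<eta> x)) =
      (LINT x|M. complex_of_real (inner (\<xi> x) (\<eta> x)) + \<i> * complex_of_real (inner (\<xi> x) (\<i> *\<^sub>C \<eta> x)))"
    by (simp add: cinner_conv_inner Complex_eq)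
  also have "\<dots> = complex_of_real (LINT x|M. inner (\<xi> x) (\<eta> x))
      + \<i> * complex_of_real (LINT x|M. inner (\<xi> x) (\<i> *\<^sub>C \<eta> x))"
    using int by (simp add: integral_add)
  finally show ?thesis by (simp add: Complex_eq)
qed

lemma L2_inner_L2_class:
  fixes \<xi> \<eta> :: "'a \<Rightarrow> 'h"
  assumes \<xi>: "\<xi> \<in> square_integrable M" and \<eta>: "\<eta> \<in> square_integrable M"
  shows "L2_inner M (L2_class M \<xi>) (L2_class M \<eta>) = (LINT x|M. cinner (\<xi> x) (\<eta> x))"
proof -
  let ?\<xi> = "L2_rep (L2_class M \<xi>)" and ?\<eta> = "L2_rep (L2_class M \<eta>)"
  have \<xi>': "?\<xi> \<in> square_integrable M" and \<eta>': "?\<eta> \<in> square_integrable M"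
    using L2_rep_square_integrable[OF L2_class_in_L2] \<xi> \<eta> by auto
  have AE: "AE x in M. ?\<xi> x = \<xi> x \<and> ?\<eta> x = \<eta> x"
    using L2_rep_L2_class_AE[OF \<xi>] L2_rep_L2_class_AE[OF \<eta>] by eventually_elim simp
  have "(LINT x|M. inner (?\<xi> x) (c *\<^sub>C ?\<eta> x)) = (LINT x|M. inner (\<xi> x) (c *\<^sub>C \<eta> x))" for c
  proof (rule integral_cong_AE)
    show "AE x in M. inner (?\<xi> x) (c *\<^sub>C ?\<eta> x) = inner (\<xi> x) (c *\<^sub>C \<eta> x)"
      using AE by eventually_elim simp
  qed (intro borel_measurable_integrable integrable_inner square_integrable_scaleC sep \<xi> \<eta> \<xi>' \<eta>')+
  from this[of 1] this[of \<i>] show ?thesis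
    by (simp add: L2_inner_def integral_cinner \<xi> \<eta> \<xi>' \<eta>' complex_vector.scale_one)
qed

end


section \<open>Closed subspaces and their projections\<close>

text \<open>
  The union of the classes in \<open>W\<close>: passing to it replaces operations on classes and their chosen
  representatives by pointwise operations on functions.
\<close>

definition functions_of :: "'a measure \<Rightarrow> ('a \<Rightarrow> 'h::complex_inner) set set \<Rightarrow> ('a \<Rightarrow> 'h) set"
  where "functions_of M W = {\<xi> \<in> square_integrable M. L2_class M \<xi> \<in> W}"

context
  fixes M :: "'a measure" and W :: "('a \<Rightarrow> 'h::complex_hilbert) set set"
  assumes sep: "separable_space (euclidean :: 'h topology)"
    and W: "L2_closed_subspace M W"
begin

lemma subspace_subset_L2: "W \<subseteq> L2 M"
  using W by (simp add: L2_closed_subspace_def)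

lemma functions_of_square_integrable: "\<xi> \<in> functions_of M W \<Longrightarrow> \<xi> \<in> square_integrable M"
  by (simp add: functions_of_def)

lemma mem_class_in_functions_of: "F \<in> W \<Longrightarrow> \<xi> \<in> F \<Longrightarrow> \<xi> \<in> functions_of M W"
  using mem_L2_class subspace_subset_L2 by (fastforce simp: functions_of_def)

lemma L2_rep_in_functions_of: "F \<in> W \<Longrightarrow> L2_rep F \<in> functions_of M W"
  using mem_class_in_functions_of L2_rep_in subspace_subset_L2 by blast

lemma functions_of_scaleC:
  assumes "\<xi> \<in> functions_of M W"
  shows "(\<lambda>x. c *\<^sub>C \<xi> x) \<in> functions_of M W"
proof -
  have \<xi>: "\<xi> \<in> square_integrable M" using assms by (simp add: functions_of_def)
  note \<xi>' = L2_rep_square_integrable[OF L2_class_in_L2[OF \<xi>]]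
  have "L2_scale M c (L2_class M \<xi>) = L2_class M (\<lambda>x. c *\<^sub>C \<xi> x)"
    unfolding L2_scale_def
    using L2_rep_L2_class_AE[OF \<xi>]
    by (intro L2_class_cong square_integrable_scaleC sep \<xi> \<xi>') (auto elim: eventually_mono)
  moreover have "L2_scale M c (L2_class M \<xi>) \<in> W"
    using W assms by (simp add: L2_closed_subspace_def functions_of_def)
  ultimately show ?thesis
    by (simp add: functions_of_def square_integrable_scaleC sep \<xi>)
qed

lemma functions_of_add:
  assumes "\<xi> \<in> functions_of M W" "\<eta> \<in> functions_of M W"
  shows "(\<lambda>x. \<xi> x + \<eta> x) \<in> functions_of M W"
proof -
  have \<xi>: "\<xi> \<in> square_integrable M" and \<eta>: "\<eta> \<in> square_integrable M"
    using assms by (simp_all add: functions_of_def)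
  note \<xi>' = L2_rep_square_integrable[OF L2_class_in_L2[OF \<xi>]]
    and \<eta>' = L2_rep_square_integrable[OF L2_class_in_L2[OF \<eta>]]
  have "L2_add M (L2_class M \<xi>) (L2_class M \<eta>) = L2_class M (\<lambda>x. \<xi> x + \<eta> x)"
    unfolding L2_add_def
    using L2_rep_L2_class_AE[OF \<xi>] L2_rep_L2_class_AE[OF \<eta>]
    by (intro L2_class_cong square_integrable_add sep \<xi> \<xi>' \<eta> \<eta>') (auto elim: eventually_elim2)
  moreover have "L2_add M (L2_class M \<xi>) (L2_class M \<eta>) \<in> W"
    using W assms by (simp add: L2_closed_subspace_def functions_of_def)
  ultimately show ?thesis
    by (simp add: functions_of_def square_integrable_add sep \<xi> \<eta>)
qed

lemma functions_of_scaleR: "\<xi> \<in> functions_of M W \<Longrightarrow> (\<lambda>x. r *\<^sub>R \<xi> x) \<in> functions_of M W"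
  using functions_of_scaleC[of \<xi> "complex_of_real r"] by (simp add: scaleR_scaleC)

lemma functions_of_diff:
  "\<xi> \<in> functions_of M W \<Longrightarrow> \<eta> \<in> functions_of M W \<Longrightarrow> (\<lambda>x. \<xi> x - \<eta> x) \<in> functions_of M W"
  using functions_of_add[OF _ functions_of_scaleR[of \<eta> "-1"], of \<xi>] by simp

text \<open>
  Closedness of \<open>W\<close> for the topology of the distance between classes, in the form that
  \<open>L2_nearest_point\<close> requires.
\<close>

lemma functions_of_closed:
  assumes \<xi>: "\<xi> \<in> square_integrable M"
    and approx: "\<And>e. e > 0 \<Longrightarrow> \<exists>\<eta>\<in>functions_of M W. sqnorm M (\<lambda>x. \<xi> x - \<eta> x) < e"
  shows "\<xi> \<in> functions_of M W"
proof (rule ccontr)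
  assume "\<xi> \<notin> functions_of M W"
  interpret L2: Metric_space "L2 M :: ('a \<Rightarrow> 'h) set set" "L2_dist M"
    using sep by (rule Metric_space_L2)
  have "L2_class M \<xi> \<in> L2 M - W"
    using \<xi> \<open>\<xi> \<notin> _\<close> by (simp add: functions_of_def L2_class_in_L2)
  moreover have "closedin L2.mtopology W"
    using W by (simp add: L2_closed_subspace_def L2_topology_def)
  ultimately obtain r where r: "r > 0" "disjnt W (L2.mball (L2_class M \<xi>) r)"
    unfolding L2.closedin_metric by blast
  obtain \<eta> where \<eta>: "\<eta> \<in> functions_of M W" and near: "sqnorm M (\<lambda>x. \<xi> x - \<eta> x) < r\<^sup>2"
    using approx[of "r\<^sup>2"] r(1) by auto
  have \<eta>_si: "\<eta> \<in> square_integrable M" using \<eta> by (simp add: functions_of_def)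
  have "L2_dist M (L2_class M \<xi>) (L2_class M \<eta>) < r"
    using near r(1) by (simp add: L2_dist_L2_class[OF sep \<xi> \<eta>_si] real_less_lsqrt)
  then have "L2_class M \<eta> \<in> L2.mball (L2_class M \<xi>) r"
    using \<xi> \<eta>_si by (simp add: L2_class_in_L2)
  then show False
    using r(2) \<eta> by (auto simp: disjnt_iff functions_of_def)
qed

text \<open>
  Real orthogonality suffices because \<open>W\<close> is stable under multiplication by \<open>\<i>\<close>.
\<close>

lemma orthogonal_iff_real:
  assumes \<zeta>: "\<zeta> \<in> square_integrable M"
  shows "(\<forall>G\<in>W. L2_inner M (L2_class M \<zeta>) G = 0) \<longleftrightarrow>
    (\<forall>\<eta>\<in>functions_of M W. (LINT x|M. inner (\<zeta> x) (\<eta> x)) = 0)" (is "?l \<longleftrightarrow> ?r")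
proof
  assume l: ?l
  show ?r
  proof
    fix \<eta> assume \<eta>: "\<eta> \<in> functions_of M W"
    then have "L2_inner M (L2_class M \<zeta>) (L2_class M \<eta>) = 0"
      using l by (simp add: functions_of_def)
    then show "(LINT x|M. inner (\<zeta> x) (\<eta> x)) = 0"
      using \<eta> by (simp add: L2_inner_L2_class integral_cinner sep \<zeta> functions_of_square_integrable
          complex_eq_iff)
  qed
next
  assume r: ?r
  show ?l
  proof
    fix G assume G: "G \<in> W"
    have \<eta>: "L2_rep G \<in> functions_of M W" by (rule L2_rep_in_functions_of[OF G])
    have "L2_inner M (L2_class M \<zeta>) G = L2_inner M (L2_class M \<zeta>) (L2_class M (L2_rep G))"
      using G subspace_subset_L2 by (simp add: L2_class_L2_rep subset_iff)
    also have "\<dots> = 0"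
      using r \<eta> functions_of_scaleC[OF \<eta>, of \<i>]
      by (simp add: L2_inner_L2_class integral_cinner sep \<zeta> functions_of_square_integrable
          complex_eq_iff)
    finally show "L2_inner M (L2_class M \<zeta>) G = 0" .
  qed
qed

text \<open>
  This makes the definite description in \<open>L2_proj\<close> meaningful. Uniqueness: the difference of two
  candidates lies in \<open>W\<close> and is orthogonal to \<open>W\<close>.
\<close>

lemma L2_proj_unique_existence:
  assumes F: "F \<in> L2 M"
  shows "\<exists>!P. P \<in> W \<and> (\<forall>G\<in>W. L2_inner M (L2_diff M F P) G = 0)"
proof -
  note \<xi> = L2_rep_square_integrable[OF F]
  have orth_iff: "(\<forall>G\<in>W. L2_inner M (L2_diff M F P) G = 0) \<longleftrightarrow>
      (\<forall>\<eta>\<in>functions_of M W. (LINT x|M. inner (L2_rep F x - L2_rep P x) (\<eta> x)) = 0)" if "P \<in> W" for P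
    unfolding L2_diff_def
    by (intro orthogonal_iff_real square_integrable_diff sep \<xi>
        functions_of_square_integrable L2_rep_in_functions_of that)
  show ?thesis
  proof (rule ex_ex1I)
    have "L2_zero M \<in> W" using W by (simp add: L2_closed_subspace_def)
    then have "functions_of M W \<noteq> {}" using L2_rep_in_functions_of by blast
    then obtain p where p: "p \<in> functions_of M W"
      and orth: "\<And>\<eta>. \<eta> \<in> functions_of M W \<Longrightarrow> (LINT x|M. inner (L2_rep F x - p x) (\<eta> x)) = 0"
      using L2_projection_exists[OF sep _ _ functions_of_add functions_of_scaleR functions_of_closed \<xi>]
        functions_of_square_integrable by blast
    have p_si: "p \<in> square_integrable M" using p by (rule functions_of_square_integrable)
    have PW: "L2_class M p \<in> W" using p by (simp add: functions_of_def)
    have "L2_diff M F (L2_class M p) = L2_class M (\<lambda>x. L2_rep F x - p x)"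
      unfolding L2_diff_def
      using L2_rep_L2_class_AE[OF p_si]
      by (intro L2_class_cong square_integrable_diff sep \<xi> p_si
          L2_rep_square_integrable L2_class_in_L2) (auto elim: eventually_mono)
    moreover have "\<forall>G\<in>W. L2_inner M (L2_class M (\<lambda>x. L2_rep F x - p x)) G = 0"
      using orth by (subst orthogonal_iff_real) (auto intro!: square_integrable_diff sep \<xi> p_si)
    ultimately show "\<exists>P. P \<in> W \<and> (\<forall>G\<in>W. L2_inner M (L2_diff M F P) G = 0)"
      using PW by auto
  next
    fix P Q
    assume P: "P \<in> W \<and> (\<forall>G\<in>W. L2_inner M (L2_diff M F P) G = 0)"
      and Q: "Q \<in> W \<and> (\<forall>G\<in>W. L2_inner M (L2_diff M F Q) G = 0)"
    let ?p = "L2_rep P" and ?q = "L2_rep Q" and ?\<xi> = "L2_rep F"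
    have p: "?p \<in> functions_of M W" and q: "?q \<in> functions_of M W"
      using P Q L2_rep_in_functions_of by auto
    note p_si = functions_of_square_integrable[OF p] and q_si = functions_of_square_integrable[OF q]
    have diff: "(\<lambda>x. ?p x - ?q x) \<in> functions_of M W"
      by (rule functions_of_diff[OF p q])
    note diff_si = functions_of_square_integrable[OF diff]
    have p0: "(LINT x|M. inner (?\<xi> x - ?p x) (?p x - ?q x)) = 0"
      using bspec[OF iffD1[OF orth_iff[of P]] diff] P by simp
    have q0: "(LINT x|M. inner (?\<xi> x - ?q x) (?p x - ?q x)) = 0"
      using bspec[OF iffD1[OF orth_iff[of Q]] diff] Q by simp
    have "sqnorm M (\<lambda>x. ?p x - ?q x) =
        (LINT x|M. inner (?\<xi> x - ?q x) (?p x - ?q x) - inner (?\<xi> x - ?p x) (?p x - ?q x))"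
      by (simp add: sqnorm_def power2_norm_eq_inner inner_diff_left)
    also have "\<dots> = 0"
      using p0 q0 by (subst Bochner_Integration.integral_diff)
        (auto intro!: integrable_inner square_integrable_diff sep \<xi> p_si q_si)
    finally have "AE x in M. ?p x = ?q x"
      using sqnorm_eq_0_iff[OF sep diff_si] by simp
    then have "L2_class M ?p = L2_class M ?q"
      by (intro L2_class_cong p_si q_si)
    then show "P = Q"
      using P Q subspace_subset_L2 by (simp add: L2_class_L2_rep subset_iff)
  qed
qed

lemma L2_proj_properties:
  assumes F: "F \<in> L2 M" and p: "p \<in> L2_proj M W F"
  shows "p \<in> functions_of M W"
    and "\<And>\<eta>. \<eta> \<in> functions_of M W \<Longrightarrow> (LINT x|M. inner (L2_rep F x - p x) (\<eta> x)) = 0"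
proof -
  have P: "L2_proj M W F \<in> W" "\<forall>G\<in>W. L2_inner M (L2_diff M F (L2_proj M W F)) G = 0"
    using theI'[OF L2_proj_unique_existence[OF F]] unfolding L2_proj_def by auto
  show pV: "p \<in> functions_of M W"
    using mem_class_in_functions_of P(1) p by blast
  note \<xi> = L2_rep_square_integrable[OF F]
    and p_si = functions_of_square_integrable[OF pV]
  have PL2: "L2_proj M W F \<in> L2 M" using P(1) subspace_subset_L2 by blast
  have "L2_class M (L2_rep (L2_proj M W F)) = L2_class M p"
    using mem_L2_class(2)[OF PL2 p] L2_class_L2_rep[OF PL2] by simp
  then have "AE x in M. L2_rep (L2_proj M W F) x = p x"
    using p_si by (rule AE_eq_of_L2_class_eq)
  then have "L2_diff M F (L2_proj M W F) = L2_class M (\<lambda>x. L2_rep F x - p x)"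
    unfolding L2_diff_def
    by (intro L2_class_cong square_integrable_diff sep \<xi> p_si L2_rep_square_integrable PL2)
      (auto elim: eventually_mono)
  then show "(LINT x|M. inner (L2_rep F x - p x) (\<eta> x)) = 0" if "\<eta> \<in> functions_of M W" for \<eta>
    using P(2) that orthogonal_iff_real[OF square_integrable_diff[OF sep \<xi> p_si]] by simp
qed

lemma L2_proj_nonempty:
  assumes F: "F \<in> L2 M"
  obtains p where "p \<in> L2_proj M W F"
proof -
  have "L2_proj M W F \<in> W"
    using theI'[OF L2_proj_unique_existence[OF F]] unfolding L2_proj_def by auto
  then show thesis using that L2_rep_in subspace_subset_L2 by blast
qed


section \<open>The pointwise description of the projection\<close>

text \<open>
  Pythagoras: the projection of an arbitrary class is at least as close to an element of \<open>W\<close> as the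
  class itself. Hence the projections of a dense family are dense in \<open>W\<close>.
\<close>

lemma sqnorm_projection_le:
  assumes \<xi>: "\<xi> \<in> functions_of M W" and F: "F \<in> L2 M" and p: "p \<in> L2_proj M W F"
  shows "sqnorm M (\<lambda>x. \<xi> x - p x) \<le> sqnorm M (\<lambda>x. \<xi> x - L2_rep F x)"
proof -
  note pV = L2_proj_properties(1)[OF F p] and orth = L2_proj_properties(2)[OF F p]
  note d = functions_of_diff[OF pV \<xi>]
  note si = functions_of_square_integrable[OF \<xi>] functions_of_square_integrable[OF pV]
    functions_of_square_integrable[OF d] L2_rep_square_integrable[OF F]
  have "sqnorm M (\<lambda>x. \<xi> x - L2_rep F x)
      = sqnorm M (\<lambda>x. (L2_rep F x - p x) + 1 *\<^sub>R (p x - \<xi> x))"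
    by (simp add: sqnorm_def norm_minus_commute)
  also have "\<dots> = sqnorm M (\<lambda>x. L2_rep F x - p x) + sqnorm M (\<lambda>x. p x - \<xi> x)"
    using orth[OF d] sqnorm_add_scaleR[OF sep square_integrable_diff[OF sep si(4,2)] si(3), of 1]
    by simp
  also have "\<dots> \<ge> sqnorm M (\<lambda>x. p x - \<xi> x)" by simp
  finally show ?thesis by (simp add: sqnorm_def norm_minus_commute)
qed

context
  fixes A :: "('a \<Rightarrow> 'h) set set" and f :: "('a \<Rightarrow> 'h) set \<Rightarrow> 'a \<Rightarrow> 'h"
  assumes A: "A \<subseteq> L2 M" and dense: "L2_topology M closure_of A = L2 M"
    and f: "\<And>\<Phi>. \<Phi> \<in> A \<Longrightarrow> f \<Phi> \<in> L2_proj M W \<Phi>"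
begin

text \<open>
  Elements of \<open>W\<close> are approximated in the square norm by the chosen representatives \<open>f \<Phi>\<close>, so
  almost every value is a limit of vectors \<open>f \<Phi> x\<close>.
\<close>

lemma AE_in_range_fun:
  assumes \<xi>: "\<xi> \<in> functions_of M W"
  shows "AE x in M. \<xi> x \<in> range_fun A f x"
proof -
  interpret L2: Metric_space "L2 M :: ('a \<Rightarrow> 'h) set set" "L2_dist M"
    using sep by (rule Metric_space_L2)
  note \<xi>_si = functions_of_square_integrable[OF \<xi>]
  have "\<exists>\<eta>\<in>f ` A. sqnorm M (\<lambda>x. \<xi> x - \<eta> x) < e" if e: "e > 0" for e
  proof -
    have "L2_class M \<xi> \<in> L2.mtopology closure_of A"
      using dense L2_class_in_L2[OF \<xi>_si] by (simp add: L2_topology_def)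
    moreover have "sqrt e > 0" using e by simp
    ultimately obtain \<Phi> where \<Phi>: "\<Phi> \<in> A" "L2_dist M (L2_class M \<xi>) \<Phi> < sqrt e"
      unfolding L2.metric_closure_of L2.in_mball by blast
    then have \<Phi>L2: "\<Phi> \<in> L2 M" using A by blast
    have "sqnorm M (\<lambda>x. \<xi> x - L2_rep \<Phi> x) < e"
      using \<Phi>(2) L2_dist_L2_class[OF sep \<xi>_si L2_rep_square_integrable[OF \<Phi>L2]]
      by (simp add: L2_class_L2_rep[OF \<Phi>L2])
    then have "sqnorm M (\<lambda>x. \<xi> x - f \<Phi> x) < e"
      using sqnorm_projection_le[OF \<xi> \<Phi>L2 f[OF \<Phi>(1)]] by simp
    then show ?thesis using \<Phi>(1) by blast
  qed
  moreover have "f ` A \<subseteq> square_integrable M"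
    using L2_proj_properties(1) f A functions_of_square_integrable by blast
  ultimately have "AE x in M. \<xi> x \<in> closure ((\<lambda>\<eta>. \<eta> x) ` f ` A)"
    by (intro AE_in_closure_of_L2_approximation sep \<xi>_si)
  then show ?thesis
  proof eventually_elim
    case (elim x)
    moreover have "(\<lambda>\<eta>. \<eta> x) ` f ` A \<subseteq> cspan ((\<lambda>\<Phi>. f \<Phi> x) ` A)"
      by (auto intro: complex_vector.span_base)
    ultimately show ?case
      unfolding range_fun_def using closure_mono by blast
  qed
qed

lemma csubspace_range_fun: "csubspace (range_fun A f x)"
  unfolding range_fun_def by (intro csubspace_closure complex_vector.subspace_span)

text \<open>
  The heart of the matter: the projection \<open>p\<close> of \<open>\<xi>\<close> onto \<open>W\<close> is computed fibrewise, as \<open>p x\<close> is almost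
  everywhere the orthogonal projection of \<open>\<xi> x\<close> onto the fibre. Membership in the fibre holds
  because \<open>p\<close> belongs to \<open>W\<close>, and orthogonality is the orthogonality condition applied to \<open>\<xi> - p\<close>.
\<close>

lemma pointwise_projection:
  assumes cond: "orthogonality_condition M W (range_fun A f)" and \<xi>: "\<xi> \<in> square_integrable M"
  obtains p where "p \<in> functions_of M W"
    "AE x in M. p x \<in> range_fun A f x \<and> (\<forall>v\<in>range_fun A f x. cinner (\<xi> x - p x) v = 0)"
proof -
  obtain p where p: "p \<in> L2_proj M W (L2_class M \<xi>)"
    using L2_proj_nonempty[OF L2_class_in_L2[OF \<xi>]] .
  note pV = L2_proj_properties(1)[OF L2_class_in_L2[OF \<xi>] p]
    and orth = L2_proj_properties(2)[OF L2_class_in_L2[OF \<xi>] p]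
  let ?\<xi> = "L2_rep (L2_class M \<xi>)"
  have \<zeta>: "(\<lambda>x. ?\<xi> x - p x) \<in> square_integrable M"
    by (intro square_integrable_diff sep functions_of_square_integrable[OF pV]
        L2_rep_square_integrable L2_class_in_L2 \<xi>)
  let ?F = "L2_class M (\<lambda>x. ?\<xi> x - p x)"
  have "\<forall>G\<in>W. L2_inner M ?F G = 0"
    using orth orthogonal_iff_real[OF \<zeta>] by blast
  then have "AE x in M. \<forall>v\<in>range_fun A f x. cinner (L2_rep ?F x) v = 0"
    using cond L2_class_in_L2[OF \<zeta>] by (simp add: orthogonality_condition_def)
  then have "AE x in M. p x \<in> range_fun A f x \<and> (\<forall>v\<in>range_fun A f x. cinner (\<xi> x - p x) v = 0)"
    using AE_in_range_fun[OF pV] L2_rep_L2_class_AE[OF \<zeta>] L2_rep_L2_class_AE[OF \<xi>]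
    by eventually_elim auto
  then show thesis using that pV by blast
qed

text \<open>
  If \<open>F\<close> takes values in the fibres and \<open>p\<close> represents its projection onto \<open>W\<close>, then the difference takes
  values in the fibres and is orthogonal to them, so it vanishes.
\<close>

lemma direct_integral_subset:
  assumes cond: "orthogonality_condition M W (range_fun A f)"
    and F: "F \<in> L2 M" and FJ: "AE x in M. L2_rep F x \<in> range_fun A f x"
  shows "F \<in> W"
proof -
  note \<xi> = L2_rep_square_integrable[OF F]
  obtain p where pV: "p \<in> functions_of M W"
    and p: "AE x in M. p x \<in> range_fun A f x \<and>
      (\<forall>v\<in>range_fun A f x. cinner (L2_rep F x - p x) v = 0)"
    using pointwise_projection[OF cond \<xi>] .
  have "AE x in M. L2_rep F x = p x"
    using p FJ
  proof eventually_elim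
    case (elim x)
    then have "L2_rep F x - p x \<in> range_fun A f x"
      using csubspace_diff[OF csubspace_range_fun] by blast
    then have "cinner (L2_rep F x - p x) (L2_rep F x - p x) = 0"
      using elim by blast
    then show ?case by (simp add: cinner_self)
  qed
  then have "L2_class M (L2_rep F) = L2_class M p"
    by (intro L2_class_cong \<xi> functions_of_square_integrable[OF pV])
  then show ?thesis
    using pV by (simp add: functions_of_def L2_class_L2_rep[OF F])
qed

text \<open>
  A constant vector \<open>a\<close> need not be square integrable, but \<open>s x *\<^sub>R a\<close> is, for a strictly positive
  square integrable scalar function \<open>s\<close>; such an \<open>s\<close> exists by sigma-finiteness. The fibrewise
  projection of \<open>a\<close> is then, almost everywhere, \<open>1 / s x\<close> times a representative of the projection of
  \<open>s x *\<^sub>R a\<close> onto \<open>W\<close>, and this is weakly measurable.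
\<close>

lemma measurable_range_fun:
  assumes "complete_measure M" "sigma_finite_measure M"
    and cond: "orthogonality_condition M W (range_fun A f)"
  shows "measurable_range_function M (range_fun A f)"
  unfolding measurable_range_function_def
proof (intro conjI ballI allI)
  fix x
  show "csubspace (range_fun A f x)" by (rule csubspace_range_fun)
  show "closed (range_fun A f x)" by (simp add: range_fun_def)
next
  interpret complete_measure M by fact
  interpret sigma_finite_measure M by fact
  fix a b :: 'h
  obtain w where w[measurable]: "w \<in> borel_measurable M" and w_fin: "integral\<^sup>N M w \<noteq> \<infinity>"
    and w_pos: "\<And>x. x \<in> space M \<Longrightarrow> 0 < w x \<and> w x < \<infinity>"
    using Ex_finite_integrable_function by blast
  define s where "s x = sqrt (enn2real (w x))" for x
  have [measurable]: "s \<in> borel_measurable M" unfolding s_def by measurable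
  have s_pos: "s x > 0" if "x \<in> space M" for x
    using w_pos[OF that] by (simp add: s_def enn2real_positive_iff)
  have s_sq: "(s x)\<^sup>2 = enn2real (w x)" for x by (simp add: s_def)
  have "integrable M (\<lambda>x. (s x)\<^sup>2)"
  proof (rule integrableI_nonneg)
    have "(\<integral>\<^sup>+x. (s x)\<^sup>2 \<partial>M) = integral\<^sup>N M w"
    proof (rule nn_integral_cong)
      show "ennreal ((s x)\<^sup>2) = w x" if "x \<in> space M" for x
        using w_pos[OF that] by (simp add: s_sq)
    qed
    then show "(\<integral>\<^sup>+x. (s x)\<^sup>2 \<partial>M) < \<infinity>" using w_fin by (simp add: top.not_eq_extremum)
  qed auto
  then have "(\<lambda>x. s x *\<^sub>R a) \<in> square_integrable M"
    by (simp add: square_integrable_def weakly_measurable_iff_inner power_mult_distrib)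
  then obtain p where pV: "p \<in> functions_of M W"
    and p: "AE x in M. p x \<in> range_fun A f x \<and>
      (\<forall>v\<in>range_fun A f x. cinner (s x *\<^sub>R a - p x) v = 0)"
    using pointwise_projection[OF cond] by blast
  have [measurable]: "(\<lambda>x. cinner (p x) b) \<in> borel_measurable M"
    using functions_of_square_integrable[OF pV] by (simp add: square_integrable_def weakly_measurable_def)
  have "AE x in M. cinner (orth_proj (range_fun A f x) a) b = complex_of_real (1 / s x) * cinner (p x) b"
    using p AE_space
  proof eventually_elim
    case (elim x)
    have "orth_proj (range_fun A f x) a = (1 / s x) *\<^sub>R p x"
    proof (rule orth_proj_eqI[OF csubspace_range_fun])
      show "(1 / s x) *\<^sub>R p x \<in> range_fun A f x"
        using elim csubspace_scaleR[OF csubspace_range_fun] by blast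
      have "a - (1 / s x) *\<^sub>R p x = (1 / s x) *\<^sub>R (s x *\<^sub>R a - p x)"
        using s_pos[OF elim(2)] by (simp add: scaleR_diff_right)
      then show "cinner (a - (1 / s x) *\<^sub>R p x) v = 0" if "v \<in> range_fun A f x" for v
        using elim that by (simp add: cinner_scaleR_left)
    qed
    then show ?case by (simp only: cinner_scaleR_left)
  qed
  then show "(\<lambda>x. cinner (orth_proj (range_fun A f x) a) b) \<in> borel_measurable M"
    by (rule borel_measurable_AE_complete[OF \<open>complete_measure M\<close> _ , rotated]) measurable
qed

end

end

theorem theorem3p8p19:
  fixes M :: "'a measure"
    and A W :: "('a \<Rightarrow> 'h::complex_hilbert) set set"
    and f :: "('a \<Rightarrow> 'h) set \<Rightarrow> 'a \<Rightarrow> 'h"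
  assumes "complete_measure M"
    and "sigma_finite_measure M"
    and "separable_space (L2_topology M :: ('a \<Rightarrow> complex) set topology)"
    and "separable_space (euclidean :: 'h topology)"
    and "A \<subseteq> L2 M" and "countable A" and "L2_topology M closure_of A = L2 M"
    and "L2_closed_subspace M W"
    and "\<And>\<Phi>. \<Phi> \<in> A \<Longrightarrow> f \<Phi> \<in> L2_proj M W \<Phi>"
    and "orthogonality_condition M W (range_fun A f)"
  shows "W = direct_integral M (range_fun A f)"
proof -
  note setting = assms(4,8,5,7,9)
  have "measurable_range_function M (range_fun A f)"
    by (rule measurable_range_fun[OF setting assms(1,2,10)])
  then have "direct_integral M (range_fun A f) =
      {F \<in> L2 M. AE x in M. L2_rep F x \<in> range_fun A f x}"
    by (simp add: direct_integral_def)
  also have "\<dots> = W"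
  proof (intro equalityI subsetI)
    fix F assume "F \<in> {F \<in> L2 M. AE x in M. L2_rep F x \<in> range_fun A f x}"
    then show "F \<in> W" using direct_integral_subset[OF setting assms(10)] by blast
  next
    fix F assume "F \<in> W"
    then show "F \<in> {F \<in> L2 M. AE x in M. L2_rep F x \<in> range_fun A f x}"
      using AE_in_range_fun[OF setting] L2_rep_in_functions_of[OF assms(4,8)]
        subspace_subset_L2[OF assms(4,8)] by blast
  qed
  finally show ?thesis by simp
qed

end
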